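(* Let $\underline{\mathbf d}=(a_1,\dots,a_r,b;n)$ be a dimension vector with $\sum_{i=1}^r a_i=n$, with size $|\underline{\mathbf d}|=b$, and with $a_i+b\le n$ for all $1\le i\le r$. Then $\underline{\mathbf d}$ is dense if the dimension vector $\underline{\mathbf d}'=(a_1,\dots,a_r;b)$ is dense.
   Context: Work over an algebraically closed field of arbitrary characteristic. $Gr(d;n)$ is the Grassmannian of $d$-dimensional linear subspaces of a fixed $n$-dimensional vector space. A dimension vector $(d_1,\dots,d_m;n)$ consists of integers with $1\le d_i\le n-1$; its size is $\max_i d_i$. It is dense if the diagonal action of $\mathbb{P}GL(n)$ on $\prod_{i} Gr(d_i;n)$ has a Zariski dense orbit. In the vector $\underline{\mathbf d}'$, entries equal to the ambient dimension $b$ are allowed; the corresponding Grassmannian is a point, so such entries can be dropped. *)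

theory Defs
  imports
    "HOL-Analysis.Abstract_Topology"
    "Jordan_Normal_Form.VS_Connect"
    "Jordan_Normal_Form.DL_Submatrix"
begin

section \<open>Grassmannians and the action of the projective linear group\<close>

definition grassmannian :: "nat \<Rightarrow> nat \<Rightarrow> 'k::field vec set set" where
  "grassmannian d n =
     {W. VectorSpace.subspace class_ring W (module_vec TYPE('k) n) \<and>
         vectorspace.dim class_ring (module_vec TYPE('k) n\<lparr>carrier := W\<rparr>) = d}"

definition prod_grassmannian :: "nat list \<Rightarrow> nat \<Rightarrow> 'k::field vec set list set" where
  "prod_grassmannian ds n = listset (map (\<lambda>d. grassmannian d n) ds)"

text \<open>Elements of the projective linear group are classes of invertible matrices modulo nonzero
  scalars.\<close>

definition PGL :: "nat \<Rightarrow> 'k::field mat set set" where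
  "PGL n = {{c \<cdot>\<^sub>m A | c. c \<noteq> 0} | A. A \<in> carrier_mat n n \<and> invertible_mat A}"

text \<open>All matrices of a class have the same effect on a linear subspace \<open>W\<close>, so \<open>pgl_act g W\<close> is
  \<open>{A *\<^sub>v v | v. v \<in> W}\<close> for any single representative \<open>A\<close> of \<open>g\<close>.\<close>

definition pgl_act :: "'k::field mat set \<Rightarrow> 'k vec set \<Rightarrow> 'k vec set" where
  "pgl_act g W = {A *\<^sub>v v | A v. A \<in> g \<and> v \<in> W}"

definition diagonal_orbit :: "nat \<Rightarrow> 'k::field vec set list \<Rightarrow> 'k vec set list set" where
  "diagonal_orbit n Ws = {map (pgl_act g) Ws | g. g \<in> PGL n}"


section \<open>The Zariski topology on a product of Grassmannians\<close>

text \<open>The tuples of homogeneous Pluecker coordinates of a point \<open>Ws\<close>: the \<open>i\<close>-th subspace is the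
  column space of some \<open>n \<times> ds ! i\<close> matrix, and its coordinate with index \<open>I\<close> is the maximal minor
  on the rows in \<open>I\<close>. The matrices are unique up to a change of basis of each column space, so
  the coordinates are unique up to one nonzero scalar per factor. Only the coordinates with
  \<open>i < length ds\<close>, \<open>I \<subseteq> {..<n}\<close> and \<open>card I = ds ! i\<close> are meaningful.\<close>

definition plucker_coords ::
    "nat list \<Rightarrow> nat \<Rightarrow> 'k::field vec set list \<Rightarrow> (nat \<Rightarrow> nat set \<Rightarrow> 'k) set" where
  "plucker_coords ds n Ws =
     {(\<lambda>i I. det (submatrix (As ! i) I UNIV)) | As.
        length As = length ds \<and>
        (\<forall>i<length ds. As ! i \<in> carrier_mat n (ds ! i) \<and>
           vec_space.col_space n (As ! i) = Ws ! i)}"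

text \<open>\<open>multihom ds n e P\<close>: \<open>P\<close> is the function given by a polynomial in the Pluecker variables
  that is homogeneous of degree \<open>e i\<close> in the variables of the \<open>i\<close>-th factor, for every \<open>i\<close>.\<close>

inductive multihom ::
    "nat list \<Rightarrow> nat \<Rightarrow> (nat \<Rightarrow> nat) \<Rightarrow> ((nat \<Rightarrow> nat set \<Rightarrow> 'k::field) \<Rightarrow> 'k) \<Rightarrow> bool"
  for ds n where
  const: "multihom ds n (\<lambda>_. 0) (\<lambda>_. c)"
| var: "i < length ds \<Longrightarrow> I \<subseteq> {..<n} \<Longrightarrow> card I = ds ! i \<Longrightarrow>
    multihom ds n (\<lambda>j. if j = i then 1 else 0) (\<lambda>x. x i I)"
| add: "multihom ds n e P \<Longrightarrow> multihom ds n e Q \<Longrightarrow> multihom ds n e (\<lambda>x. P x + Q x)"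
| mult: "multihom ds n e P \<Longrightarrow> multihom ds n e' Q \<Longrightarrow>
    multihom ds n (\<lambda>j. e j + e' j) (\<lambda>x. P x * Q x)"

text \<open>The topology induced by the Pluecker embeddings from the Zariski topology on a product of
  projective spaces: the nonvanishing loci of multihomogeneous polynomials generate it, so the
  closed sets are the common zero loci of families of such polynomials.\<close>

definition nonvanishing_locus ::
    "nat list \<Rightarrow> nat \<Rightarrow> ((nat \<Rightarrow> nat set \<Rightarrow> 'k::field) \<Rightarrow> 'k) \<Rightarrow> 'k vec set list set" where
  "nonvanishing_locus ds n P =
     {Ws \<in> prod_grassmannian ds n. \<exists>x\<in>plucker_coords ds n Ws. P x \<noteq> 0}"

definition zariski :: "nat list \<Rightarrow> nat \<Rightarrow> 'k::field vec set list topology" where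
  "zariski ds n = topology_generated_by {nonvanishing_locus ds n P | e P. multihom ds n e P}"


section \<open>Dimension vectors\<close>

definition dimension_vector :: "nat list \<Rightarrow> nat \<Rightarrow> bool" where
  "dimension_vector ds n \<longleftrightarrow> (\<forall>d\<in>set ds. 1 \<le> d \<and> d \<le> n - 1)"

definition dv_size :: "nat list \<Rightarrow> nat" where
  "dv_size ds = Max (set ds)"

text \<open>This is also used for vectors with entries equal to \<open>n\<close>; the corresponding factor
  \<open>grassmannian n n\<close> is a single point.\<close>

definition dense_dv :: "'k::field itself \<Rightarrow> nat list \<Rightarrow> nat \<Rightarrow> bool" where
  "dense_dv _ ds n \<longleftrightarrow>
     (\<exists>Ws\<in>prod_grassmannian ds n :: 'k vec set list set.
        zariski ds n closure_of diagonal_orbit n Ws = prod_grassmannian ds n)"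

end

theory Submission
  imports Defs "Jordan_Normal_Form.DL_Rank" "HOL-Computational_Algebra.Polynomial"
begin

text \<open>
  Generic subspaces of dimensions \<open>a\<^sub>1, \<dots>, a\<^sub>r\<close> in \<open>n\<close>-space are in direct sum, since
  \<open>a\<^sub>1 + \<dots> + a\<^sub>r = n\<close>. So they can be moved to the coordinate blocks, whose stabiliser in \<open>GL(n)\<close> is
  \<open>GL(a\<^sub>1) \<times> \<dots> \<times> GL(a\<^sub>r)\<close>, and the question is whether this group has a dense orbit on the
  \<open>b\<close>-dimensional subspaces. Such a subspace is the column space of an \<open>n \<times> b\<close> matrix up to \<open>GL(b)\<close>
  acting on the right. Cut the matrix into blocks of \<open>a\<^sub>i\<close> rows. As \<open>a\<^sub>i \<le> b\<close>, a generic block has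
  full rank, so modulo \<open>GL(a\<^sub>i)\<close> it is the same thing as its row space, a point of \<open>Gr(a\<^sub>i; b)\<close>. What
  remains is the diagonal action of \<open>GL(b)\<close> on the product of the \<open>Gr(a\<^sub>i; b)\<close>, which has a dense
  orbit by assumption.

  The Zariski topology is defined by multihomogeneous polynomials in Pluecker coordinates, whose
  nonvanishing loci form a basis (lemma \<open>zariski_dense_iff\<close>). Density has to be carried from the
  product of the \<open>Gr(a\<^sub>i; b)\<close> to the space of \<open>n \<times> b\<close> matrices, where a polynomial is in general not
  invariant under \<open>GL(a\<^sub>1) \<times> \<dots> \<times> GL(a\<^sub>r)\<close>. On the chart where the leading Pluecker coordinates are
  nonzero, every subspace has a normalised basis matrix. By Cramer's rule its entries are quotients
  of Pluecker coordinates (lemma \<open>normal_form_of_plucker_coordinates\<close>). Substituting them and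
  clearing denominators turns a polynomial in matrices into a multihomogeneous polynomial on the
  product of Grassmannians, which is nonzero somewhere on the dense orbit
  (lemma \<open>dense_orbit_meets\<close>). The genericity statements are proved by restriction to lines: a
  nonzero polynomial in one variable over an infinite field has only finitely many zeros.
\<close>

section \<open>Subspaces as column spaces\<close>

text \<open>Full column rank, stated through the kernel so that it is easy to compare for a product and its
  factors.\<close>

definition inj_mat :: "'k::field mat \<Rightarrow> bool" where
  "inj_mat M \<longleftrightarrow> (\<forall>v\<in>carrier_vec (dim_col M). M *\<^sub>v v = 0\<^sub>v (dim_row M) \<longrightarrow> v = 0\<^sub>v (dim_col M))"

abbreviation col_space :: "nat \<Rightarrow> 'k::field mat \<Rightarrow> 'k vec set" where
  "col_space n \<equiv> vec_space.col_space n"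

lemma col_space_eq_range:
  fixes M :: "'k::field mat"
  assumes "M \<in> carrier_mat n d"
  shows "col_space n M = {M *\<^sub>v v | v. v \<in> carrier_vec d}"
  using vec_space.col_space_eq[OF assms] assms by auto

lemma mult_unit_vec:
  fixes M :: "'k::field mat"
  assumes "M \<in> carrier_mat n d" "i < d"
  shows "M *\<^sub>v unit_vec d i = col M i"
  using assms by (intro eq_vecI) auto

lemma inj_mat_iff_dim_col_space:
  fixes M :: "'k::field mat"
  assumes M: "M \<in> carrier_mat n d"
  shows "inj_mat M \<longleftrightarrow>
    vectorspace.dim class_ring (module_vec TYPE('k) n\<lparr>carrier := col_space n M\<rparr>) = d"
proof -
  interpret vec_space "TYPE('k)" n .
  have rank: "vectorspace.dim class_ring (module_vec TYPE('k) n\<lparr>carrier := col_space M\<rparr>) = rank M"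
    by (simp add: rank_def col_space_def)
  show ?thesis unfolding rank
  proof
    assume inj: "inj_mat M"
    have "distinct (cols M)"
      unfolding distinct_conv_nth
    proof (intro allI impI notI)
      fix i j assume ij: "i < length (cols M)" "j < length (cols M)" "i \<noteq> j"
        and eq: "cols M ! i = cols M ! j"
      have i: "i < d" and j: "j < d" using ij M by auto
      have "M *\<^sub>v (unit_vec d i - unit_vec d j) = M *\<^sub>v unit_vec d i - M *\<^sub>v unit_vec d j"
        by (rule mult_minus_distrib_mat_vec[OF M]) auto
      also have "\<dots> = col M i - col M j"
        using mult_unit_vec[OF M i] mult_unit_vec[OF M j] by simp
      also have "\<dots> = 0\<^sub>v n" using eq i j M by auto
      finally have "unit_vec d i - unit_vec d j = (0\<^sub>v d :: 'k vec)"
        using inj M unfolding inj_mat_def by auto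
      then have "(unit_vec d i - unit_vec d j :: 'k vec) $ i = 0" using i by simp
      then show False using i j ij by simp
    qed
    moreover have "lin_indpt (set (cols M))"
      using lin_depE[OF M _ \<open>distinct (cols M)\<close>] inj M unfolding inj_mat_def by auto
    ultimately show "rank M = d" by (rule lin_indpt_full_rank[OF M])
  next
    assume r: "rank M = d"
    have "distinct (cols M)"
    proof (rule ccontr)
      assume "\<not> distinct (cols M)"
      then have "card (set (cols M)) < d"
        using M by (metis card_distinct card_length carrier_matD(2) cols_length nat_less_le)
      obtain S where S: "maximal S (\<lambda>T. T \<subseteq> set (cols M) \<and> lin_indpt T)"
        using maximal_exists[of "(\<lambda>T. T \<subseteq> set (cols M) \<and> lin_indpt T)" "card (set (cols M))" "{}"]
        by (meson List.finite_set card_mono empty_iff empty_subsetI finite_lin_indpt2 rev_finite_subset)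
      then have "rank M = card S" by (rule rank_card_indpt[OF M])
      also have "card S \<le> card (set (cols M))" using S by (simp add: card_mono maximal_def)
      finally show False using \<open>card (set (cols M)) < d\<close> r by simp
    qed
    then have "lin_indpt (set (cols M))" using full_rank_lin_indpt[OF M r] by blast
    then show "inj_mat M"
      using lin_depI[OF M _ _ _ \<open>distinct (cols M)\<close>] M unfolding inj_mat_def by auto
  qed
qed

text \<open>A maximal linearly independent subset of the subspace provides the columns.\<close>

lemma grassmannian_iff:
  "W \<in> grassmannian d n \<longleftrightarrow> (\<exists>M\<in>carrier_mat n d. inj_mat M \<and> col_space n M = (W :: 'k::field vec set))"
proof -
  interpret vec_space "TYPE('k)" n .
  show ?thesis
  proof
    assume W: "W \<in> grassmannian d n"
    then have sub: "subspace class_ring W V" and dim: "vectorspace.dim class_ring (vs W) = d"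
      by (auto simp: grassmannian_def)
    have W: "submodule class_ring W V" using sub by (simp add: subspace_def)
    obtain B where B: "maximal B (\<lambda>T. T \<subseteq> W \<and> lin_indpt T)"
    proof -
      have "T \<subseteq> W \<and> lin_indpt T \<Longrightarrow> finite T \<and> card T \<le> dim" for T
        using li_le_dim[OF fin_dim, of T] W unfolding submodule_def by auto
      moreover have "{} \<subseteq> W \<and> lin_indpt {}"
        using finite_lin_indpt2[of "{}"] by simp
      ultimately show ?thesis using that maximal_exists[of "\<lambda>T. T \<subseteq> W \<and> lin_indpt T" dim "{}"] by auto
    qed
    have BW: "B \<subseteq> W" and li: "lin_indpt B" using B unfolding maximal_def by auto
    have car: "W \<subseteq> carrier_vec n" using W unfolding submodule_def by simp
    have fin: "finite B" using li_le_dim(1)[OF fin_dim _ li] BW car by auto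
    have "span B = W"
    proof
      show "span B \<subseteq> W" using BW W by (rule span_is_subset)
      show "W \<subseteq> span B"
      proof (rule subsetI, rule ccontr)
        fix w assume w: "w \<in> W" "w \<notin> span B"
        then have "lin_indpt (B \<union> {w})" "w \<notin> B"
          using lin_dep_iff_in_span[of B w] li BW car span_mem[of B w] by auto
        then have "B \<union> {w} \<subseteq> W \<and> lin_indpt (B \<union> {w})" using w BW by auto
        then show False using B \<open>w \<notin> B\<close> unfolding maximal_def by blast
      qed
    qed
    obtain bs where bs: "set bs = B" "distinct bs" using finite_distinct_list[OF fin] by blast
    define M where "M = mat_of_cols n bs"
    have M: "M \<in> carrier_mat n (length bs)" unfolding M_def by auto
    have cols: "cols M = bs" unfolding M_def using bs BW car by (intro cols_mat_of_cols) auto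
    have MW: "col_space M = W" unfolding col_space_def cols bs \<open>span B = W\<close> ..
    have "rank M = length bs" using lin_indpt_full_rank[OF M] li cols bs by simp
    then have "length bs = d" using dim MW unfolding rank_def col_space_def by simp
    then show "\<exists>M\<in>carrier_mat n d. inj_mat M \<and> col_space M = W"
      using M MW inj_mat_iff_dim_col_space dim by blast
  next
    assume "\<exists>M\<in>carrier_mat n d. inj_mat M \<and> col_space M = W"
    then obtain M where M: "M \<in> carrier_mat n d" "inj_mat M" "col_space M = W" by blast
    have "set (cols M) \<subseteq> carrier_vec n" using M(1) cols_dim by blast
    then have "subspace class_ring W V"
      using span_is_subspace[of "set (cols M)"] M(3) unfolding col_space_def by simp
    then show "W \<in> grassmannian d n"
      using M inj_mat_iff_dim_col_space[OF M(1)] unfolding grassmannian_def by auto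
  qed
qed

text \<open>Inclusions of column spaces are right multiplications, and for matrices of full column rank
  equality of column spaces is a change of basis. This is how every statement about subspaces below
  becomes an identity of matrices.\<close>

lemma col_space_subsetD:
  fixes M M' :: "'k::field mat"
  assumes M: "M \<in> carrier_mat n d" and M': "M' \<in> carrier_mat n d'"
    and sub: "col_space n M' \<subseteq> col_space n M"
  obtains G where "G \<in> carrier_mat d d'" "M' = M * G"
proof -
  have "\<exists>v\<in>carrier_vec d. col M' j = M *\<^sub>v v" if j: "j < d'" for j
  proof -
    have "col M' j = M' *\<^sub>v unit_vec d' j" using mult_unit_vec[OF M' j] by simp
    then have "col M' j \<in> col_space n M'" unfolding col_space_eq_range[OF M'] by auto
    then show ?thesis using sub unfolding col_space_eq_range[OF M] by auto
  qed
  then obtain g where g: "\<And>j. j < d' \<Longrightarrow> g j \<in> carrier_vec d" "\<And>j. j < d' \<Longrightarrow> col M' j = M *\<^sub>v g j"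
    by metis
  define G where "G = mat_of_cols d (map g [0..<d'])"
  have G: "G \<in> carrier_mat d d'" unfolding G_def by auto
  have "M' = M * G"
  proof (rule eq_matI)
    fix i j assume "i < dim_row (M * G)" "j < dim_col (M * G)"
    then have i: "i < n" and j: "j < d'" using M G by auto
    have "col G j = g j" unfolding G_def using j g(1) by (simp add: col_mat_of_cols)
    then have "(M * G) $$ (i, j) = (M *\<^sub>v g j) $ i" using i j M G by simp
    then show "M' $$ (i, j) = (M * G) $$ (i, j)" using g(2)[OF j] i j M' by (metis carrier_matD index_col)
  qed (use M M' G in auto)
  with G that show ?thesis by blast
qed

lemma inj_mat_det_iff:
  fixes G :: "'k::field mat"
  assumes G: "G \<in> carrier_mat d d"
  shows "inj_mat G \<longleftrightarrow> det G \<noteq> 0"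
  using det_0_iff_vec_prod_zero_field[OF G] G unfolding inj_mat_def by auto

lemma inj_mat_mult_leftD:
  fixes M :: "'k::field mat"
  assumes M: "M \<in> carrier_mat n d" and G: "G \<in> carrier_mat d d'" and inj: "inj_mat (M * G)"
  shows "inj_mat G"
proof -
  have "v = 0\<^sub>v d'" if v: "v \<in> carrier_vec d'" "G *\<^sub>v v = 0\<^sub>v d" for v
  proof -
    have "(M * G) *\<^sub>v v = M *\<^sub>v (G *\<^sub>v v)" by (rule assoc_mult_mat_vec[OF M G v(1)])
    also have "\<dots> = 0\<^sub>v n" unfolding v using M by auto
    finally show ?thesis using inj M G v unfolding inj_mat_def by auto
  qed
  then show ?thesis unfolding inj_mat_def using G by auto
qed

lemma inj_mat_mult:
  fixes M :: "'k::field mat"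
  assumes M: "M \<in> carrier_mat n d" and G: "G \<in> carrier_mat d d'" and inj: "inj_mat M" "inj_mat G"
  shows "inj_mat (M * G)"
proof -
  have "v = 0\<^sub>v d'" if v: "v \<in> carrier_vec d'" "(M * G) *\<^sub>v v = 0\<^sub>v n" for v
  proof -
    have "(M * G) *\<^sub>v v = M *\<^sub>v (G *\<^sub>v v)" by (rule assoc_mult_mat_vec[OF M G v(1)])
    moreover have "G *\<^sub>v v \<in> carrier_vec d" using G v by auto
    ultimately have "G *\<^sub>v v = 0\<^sub>v d" using v(2) inj(1) M unfolding inj_mat_def by auto
    then show ?thesis using inj(2) v(1) G unfolding inj_mat_def by auto
  qed
  then show ?thesis unfolding inj_mat_def using M G by auto
qed

lemma same_col_space:
  fixes M M' :: "'k::field mat"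
  assumes M: "M \<in> carrier_mat n d" and M': "M' \<in> carrier_mat n d" "inj_mat M'"
    and eq: "col_space n M = col_space n M'"
  obtains G where "G \<in> carrier_mat d d" "det G \<noteq> 0" "M' = M * G"
proof -
  obtain G where G: "G \<in> carrier_mat d d" "M' = M * G"
    using col_space_subsetD[OF M M'(1)] eq by auto
  then have "inj_mat G" using inj_mat_mult_leftD[OF M G(1)] M'(2) by simp
  then show ?thesis using that G inj_mat_det_iff by blast
qed

lemma det_nonzero_inverse:
  fixes A :: "'k::field mat"
  assumes A: "A \<in> carrier_mat n n" and "det A \<noteq> 0"
  obtains B where "B \<in> carrier_mat n n" "det B \<noteq> 0" "A * B = 1\<^sub>m n" "B * A = 1\<^sub>m n"
proof -
  obtain B where B: "B \<in> carrier_mat n n" "A * B = 1\<^sub>m n" "B * A = 1\<^sub>m n"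
    using det_non_zero_imp_unit[OF A assms(2), of undefined] A
    unfolding Units_def ring_mat_def by auto
  have "det A * det B = 1" using det_mult[OF A B(1)] B(2) by simp
  then have "det B \<noteq> 0" by auto
  with B that show ?thesis by blast
qed

lemma col_space_mult_invertible:
  fixes M :: "'k::field mat"
  assumes M: "M \<in> carrier_mat n d" and G: "G \<in> carrier_mat d d" "det G \<noteq> 0"
  shows "col_space n (M * G) = col_space n M"
proof -
  obtain H where H: "H \<in> carrier_mat d d" "G * H = 1\<^sub>m d" using det_nonzero_inverse[OF G] by metis
  have MG: "M * G \<in> carrier_mat n d" using M G by auto
  have "\<exists>w\<in>carrier_vec d. M *\<^sub>v v = (M * G) *\<^sub>v w" if v: "v \<in> carrier_vec d" for v
  proof
    have "(M * G) *\<^sub>v (H *\<^sub>v v) = M *\<^sub>v (G *\<^sub>v (H *\<^sub>v v))"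
      using M G H v by (intro assoc_mult_mat_vec) auto
    also have "G *\<^sub>v (H *\<^sub>v v) = (G * H) *\<^sub>v v" by (rule assoc_mult_mat_vec[OF G(1) H(1) v, symmetric])
    also have "\<dots> = v" unfolding H(2) using v by simp
    finally show "M *\<^sub>v v = (M * G) *\<^sub>v (H *\<^sub>v v)" by (rule sym)
  qed (use H v in auto)
  moreover have "\<exists>w\<in>carrier_vec d. (M * G) *\<^sub>v v = M *\<^sub>v w" if "v \<in> carrier_vec d" for v
    using assoc_mult_mat_vec[OF M G(1) that] mult_mat_vec_carrier[OF G(1) that] by blast
  ultimately show ?thesis
    unfolding col_space_eq_range[OF M] col_space_eq_range[OF MG] by blast
qed

lemma pgl_act_col_space:
  fixes M :: "'k::field mat"
  assumes A: "A \<in> carrier_mat n n" and M: "M \<in> carrier_mat n d"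
  shows "pgl_act {c \<cdot>\<^sub>m A | c. c \<noteq> 0} (col_space n M) = col_space n (A * M)"
proof -
  have AM: "A * M \<in> carrier_mat n d" using A M by auto
  have 1: "(c \<cdot>\<^sub>m A) *\<^sub>v (M *\<^sub>v v) = (A * M) *\<^sub>v (c \<cdot>\<^sub>v v)" if "v \<in> carrier_vec d" for c v
  proof -
    have "(c \<cdot>\<^sub>m A) *\<^sub>v (M *\<^sub>v v) = c \<cdot>\<^sub>v (A *\<^sub>v (M *\<^sub>v v))"
      using A M that by (intro eq_vecI) auto
    also have "A *\<^sub>v (M *\<^sub>v v) = (A * M) *\<^sub>v v" using A M that by simp
    also have "c \<cdot>\<^sub>v \<dots> = (A * M) *\<^sub>v (c \<cdot>\<^sub>v v)" using mult_mat_vec[OF AM that] by simp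
    finally show ?thesis .
  qed
  show ?thesis unfolding pgl_act_def col_space_eq_range[OF M] col_space_eq_range[OF AM]
  proof (intro equalityI subsetI)
    fix x assume "x \<in> {A' *\<^sub>v w | A' w. A' \<in> {c \<cdot>\<^sub>m A | c. c \<noteq> 0} \<and> w \<in> {M *\<^sub>v v | v. v \<in> carrier_vec d}}"
    then obtain c v where "v \<in> carrier_vec d" "x = (c \<cdot>\<^sub>m A) *\<^sub>v (M *\<^sub>v v)" by auto
    then show "x \<in> {(A * M) *\<^sub>v v | v. v \<in> carrier_vec d}" using 1 by auto
  next
    fix x assume "x \<in> {(A * M) *\<^sub>v v | v. v \<in> carrier_vec d}"
    then obtain v where v: "v \<in> carrier_vec d" "x = (A * M) *\<^sub>v v" by auto
    then have "x = (1 \<cdot>\<^sub>m A) *\<^sub>v (M *\<^sub>v v)" using 1[OF v(1), of 1] by simp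
    then show "x \<in> {A' *\<^sub>v w | A' w. A' \<in> {c \<cdot>\<^sub>m A | c. c \<noteq> 0} \<and> w \<in> {M *\<^sub>v v | v. v \<in> carrier_vec d}}"
      using v by (smt (verit) mem_Collect_eq zero_neq_one)
  qed
qed

lemma PGL_iff:
  "g \<in> PGL n \<longleftrightarrow> (\<exists>A. A \<in> carrier_mat n n \<and> det A \<noteq> 0 \<and> g = {c \<cdot>\<^sub>m A | c. c \<noteq> (0::'k::field)})"
proof -
  have "invertible_mat A \<longleftrightarrow> det A \<noteq> 0" if A: "A \<in> carrier_mat n n" for A :: "'k mat"
  proof
    assume "invertible_mat A"
    then obtain B where B: "A * B = 1\<^sub>m n" "B * A = 1\<^sub>m (dim_row B)" "square_mat A"
      using A unfolding invertible_mat_def inverts_mat_def by auto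
    have "dim_row B = n" using B A by (metis carrier_matD(2) index_mult_mat(3) index_one_mat(3))
    moreover have "dim_col B = n" using B by (metis index_mult_mat(3) index_one_mat(3))
    ultimately have "det A * det B = 1" using det_mult[OF A, of B] B(1) by auto
    then show "det A \<noteq> 0" by auto
  next
    assume "det A \<noteq> 0"
    then obtain B where "B \<in> carrier_mat n n" "A * B = 1\<^sub>m n" "B * A = 1\<^sub>m n"
      using det_nonzero_inverse[OF A] by metis
    then show "invertible_mat A" using A unfolding invertible_mat_def inverts_mat_def by auto
  qed
  then show ?thesis unfolding PGL_def by auto
qed

section \<open>Maximal minors\<close>

abbreviation minor :: "'k::field mat \<Rightarrow> nat set \<Rightarrow> 'k" where
  "minor M I \<equiv> det (submatrix M I UNIV)"

lemma submatrix_rows: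
  assumes M: "M \<in> carrier_mat n d" and I: "I \<subseteq> {..<n}"
  shows "submatrix M I UNIV = mat (card I) d (\<lambda>(i, j). M $$ (pick I i, j))"
proof -
  have "{i. i < dim_row M \<and> i \<in> I} = I" using M I by auto
  moreover have "{j. j < dim_col M \<and> j \<in> UNIV} = {..<d}" using M by auto
  ultimately show ?thesis unfolding submatrix_def pick_UNIV by simp
qed

lemma pick_less:
  assumes "I \<subseteq> {..<n}" "i < card I"
  shows "pick I i < n"
  using assms pick_in_set_le[of i I] by auto

lemma submatrix_rows_mult:
  fixes M :: "'k::field mat"
  assumes M: "M \<in> carrier_mat n d" and G: "G \<in> carrier_mat d d'" and I: "I \<subseteq> {..<n}"
  shows "submatrix (M * G) I UNIV = submatrix M I UNIV * G"
proof -
  have MG: "M * G \<in> carrier_mat n d'" using M G by auto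
  show ?thesis
    unfolding submatrix_rows[OF MG I] submatrix_rows[OF M I]
    by (rule eq_matI) (use M G pick_less[OF I] in \<open>auto simp: scalar_prod_def\<close>)
qed

lemma submatrix_rows_carrier:
  assumes "M \<in> carrier_mat n d" "I \<subseteq> {..<n}" "card I = d"
  shows "submatrix M I UNIV \<in> carrier_mat d d"
  using submatrix_rows[OF assms(1,2)] assms(3) by simp

lemma minor_mult:
  fixes M :: "'k::field mat"
  assumes "M \<in> carrier_mat n d" "G \<in> carrier_mat d d" "I \<subseteq> {..<n}" "card I = d"
  shows "minor (M * G) I = minor M I * det G"
  unfolding submatrix_rows_mult[OF assms(1,2,3)]
  by (rule det_mult[OF submatrix_rows_carrier[OF assms(1,3,4)] assms(2)])

text \<open>A nonzero maximal minor is the open condition by which full column rank is enforced.\<close>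

lemma minor_nonzero_imp_inj_mat:
  fixes M :: "'k::field mat"
  assumes M: "M \<in> carrier_mat n d" and I: "I \<subseteq> {..<n}" "card I = d" and nz: "minor M I \<noteq> 0"
  shows "inj_mat M"
proof -
  let ?S = "submatrix M I UNIV"
  have S: "?S \<in> carrier_mat d d" by (rule submatrix_rows_carrier[OF M I])
  have "v = 0\<^sub>v d" if v: "v \<in> carrier_vec d" "M *\<^sub>v v = 0\<^sub>v n" for v
  proof -
    have "?S *\<^sub>v v = 0\<^sub>v d"
    proof (rule eq_vecI)
      fix i assume "i < dim_vec (0\<^sub>v d :: 'k vec)"
      then have i: "i < d" by simp
      then have p: "pick I i < n" using pick_less[OF I(1)] I by simp
      have "(?S *\<^sub>v v) $ i = (M *\<^sub>v v) $ pick I i"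
        using i p M v(1) I unfolding submatrix_rows[OF M I(1)]
        by (simp add: scalar_prod_def carrier_matD[OF M])
      then show "(?S *\<^sub>v v) $ i = (0\<^sub>v d :: 'k vec) $ i" using v p i by simp
    qed (use S in auto)
    then show ?thesis using nz v det_0_iff_vec_prod_zero_field[OF S] by auto
  qed
  then show ?thesis using M unfolding inj_mat_def by auto
qed

text \<open>A list of rows with a repetition gives determinant 0, and a list without repetition is a
  permutation of an increasing one. So the determinants that Cramer's rule produces are, up to signs
  that depend only on the list of rows, Pluecker coordinates.\<close>

lemma det_rows_eq_minor:
  assumes f: "\<And>i. i < d \<Longrightarrow> f i < n" and dn: "d \<le> n"
  shows "\<exists>(c::'k::field) I. I \<subseteq> {..<n} \<and> card I = d \<and>
    (\<forall>M\<in>carrier_mat n d. det (mat d d (\<lambda>(i, j). M $$ (f i, j))) = c * minor M I)"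
proof (cases "inj_on f {..<d}")
  case False
  then obtain i j where ij: "i < d" "j < d" "i \<noteq> j" "f i = f j" unfolding inj_on_def by auto
  have "det (mat d d (\<lambda>(i, j). M $$ (f i, j))) = 0" for M :: "'k mat"
    by (rule det_identical_rows[of _ d i j]) (use ij in \<open>auto intro!: eq_vecI\<close>)
  then show ?thesis using dn by (intro exI[of _ 0] exI[of _ "{..<d}"]) auto
next
  case True
  define I where "I = f ` {..<d}"
  have I: "I \<subseteq> {..<n}" "card I = d" unfolding I_def using f card_image[OF True] by auto
  have fin: "finite I" unfolding I_def by simp
  have bp: "bij_betw (pick I) {..<d} I"
  proof -
    have "inj_on (pick I) {..<d}"
      by (rule linorder_inj_onI') (metis I(2) lessThan_iff less_irrefl pick_mono_le)
    moreover have "pick I ` {..<d} \<subseteq> I" using pick_in_set_le[of _ I] I by auto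
    ultimately show ?thesis
      by (metis I(2) bij_betw_def card_image card_lessThan card_subset_eq fin)
  qed
  \<comment> \<open>\<open>pick I\<close> enumerates \<open>I\<close> increasingly; \<open>p\<close> is the permutation that sorts \<open>f\<close>, extended by the
    identity as \<open>permutes\<close> demands.\<close>
  define p where "p i = (if i < d then the_inv_into {..<d} (pick I) (f i) else i)" for i
  have bf: "bij_betw f {..<d} I" using True unfolding I_def bij_betw_def by simp
  have "bij_betw (the_inv_into {..<d} (pick I) \<circ> f) {..<d} {..<d}"
    using bij_betw_trans[OF bf bij_betw_the_inv_into[OF bp]] .
  then have "bij_betw p {..<d} {..<d}"
    by (rule bij_betw_cong[THEN iffD1, rotated]) (simp add: p_def)
  then have perm: "p permutes {0..<d}"
    by (intro bij_imp_permutes) (auto simp: p_def lessThan_atLeast0)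
  have pick: "pick I (p i) = f i" if "i < d" for i
    using f_the_inv_into_f_bij_betw[OF bp, of "f i"] that unfolding p_def I_def by auto
  have "det (mat d d (\<lambda>(i, j). M $$ (f i, j))) = signof p * minor M I"
    if M: "M \<in> carrier_mat n d" for M :: "'k mat"
  proof -
    have pd: "p i < d" if "i < d" for i using perm that by (metis atLeastLessThan_iff permutes_in_image zero_le)
    have "mat d d (\<lambda>(i, j). M $$ (f i, j)) = mat d d (\<lambda>(i, j). submatrix M I UNIV $$ (p i, j))"
      unfolding submatrix_rows[OF M I(1)] using I pd pick by (intro eq_matI) auto
    then show ?thesis using det_permute_rows[OF submatrix_rows_carrier[OF M I] perm] by simp
  qed
  then show ?thesis using I by blast
qed

text \<open>Cramer's rule for the system with matrix \<open>S\<close>: if the top \<open>d\<close> rows of \<open>M = N * S\<close> form \<open>S\<close>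
  itself, then \<open>N\<close>, the representative of the column space of \<open>M\<close> with an identity block on top, has
  entries that are quotients of Pluecker coordinates of \<open>M\<close>.\<close>

lemma normalised_matrix_entry:
  fixes N S :: "'k::field mat"
  assumes N: "N \<in> carrier_mat n d" and S: "S \<in> carrier_mat d d"
    and top: "\<And>i j. i < d \<Longrightarrow> j < d \<Longrightarrow> S $$ (i, j) = (N * S) $$ (i, j)"
    and l: "l < n" and s: "s < d"
  shows "det (mat d d (\<lambda>(i, j). (N * S) $$ ((id(s := l)) i, j))) = N $$ (l, s) * det S"
proof -
  let ?x = "row N l"
  have x: "?x \<in> carrier_vec d" using N by auto
  have "det (replace_col S\<^sup>T (S\<^sup>T *\<^sub>v ?x) s) = ?x $ s * det S\<^sup>T"
    by (rule cramer_lemma_mat) (use S x s in auto)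
  moreover have "replace_col S\<^sup>T (S\<^sup>T *\<^sub>v ?x) s = (mat d d (\<lambda>(i, j). (N * S) $$ ((id(s := l)) i, j)))\<^sup>T"
    (is "?L = ?R")
  proof (rule eq_matI)
    fix i j assume "i < dim_row ?R" "j < dim_col ?R"
    then have i: "i < d" and j: "j < d" by auto
    show "?L $$ (i, j) = ?R $$ (i, j)"
    proof (cases "j = s")
      case True
      have "?L $$ (i, j) = col S i \<bullet> row N l" using True S i j by (simp add: replace_col_def)
      also have "\<dots> = row N l \<bullet> col S i" by (rule comm_scalar_prod[of _ d]) (use S N in auto)
      also have "\<dots> = (N * S) $$ (l, i)" using S N i l by simp
      finally show ?thesis using True i s by simp
    next
      case False
      have "?L $$ (i, j) = S $$ (j, i)" using False S i j by (simp add: replace_col_def)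
      also have "\<dots> = (N * S) $$ (j, i)" by (rule top[OF j i])
      finally show ?thesis using False i j by simp
    qed
  qed (use S in \<open>auto simp: replace_col_def\<close>)
  ultimately have "det (mat d d (\<lambda>(i, j). (N * S) $$ ((id(s := l)) i, j)))\<^sup>T = ?x $ s * det S\<^sup>T" by simp
  then show ?thesis using N S l s by (simp add: det_transpose[of _ d])
qed

section \<open>Algebras of functions\<close>

text \<open>``Depends polynomially on the parameter'' is expressed by membership in a set of functions
  that contains the constants and is closed under sums and products. Minors and multihomogeneous
  polynomials then preserve membership, whatever the parameter is. Two instances are needed:
  polynomials in one variable, and the functions of Pluecker coordinates that become
  multihomogeneous polynomials when denominators are cleared.\<close>

locale function_algebra =
  fixes S :: "('a \<Rightarrow> 'k::field) \<Rightarrow> bool"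
  assumes const: "S (\<lambda>_. c)"
    and add: "S f \<Longrightarrow> S g \<Longrightarrow> S (\<lambda>x. f x + g x)"
    and mult: "S f \<Longrightarrow> S g \<Longrightarrow> S (\<lambda>x. f x * g x)"
begin

lemma sum: "(\<And>i. i \<in> I \<Longrightarrow> S (f i)) \<Longrightarrow> S (\<lambda>x. \<Sum>i\<in>I. f i x)"
  by (induction I rule: infinite_finite_induct) (simp_all add: const add)

lemma prod: "(\<And>i. i \<in> I \<Longrightarrow> S (f i)) \<Longrightarrow> S (\<lambda>x. \<Prod>i\<in>I. f i x)"
  by (induction I rule: infinite_finite_induct) (simp_all add: const mult)

lemma det:
  assumes A: "\<And>x. A x \<in> carrier_mat d d"
    and entry: "\<And>i j. i < d \<Longrightarrow> j < d \<Longrightarrow> S (\<lambda>x. A x $$ (i, j))"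
  shows "S (\<lambda>x. det (A x))"
proof -
  have "S (\<lambda>x. \<Sum>p\<in>{p. p permutes {0..<d}}. signof p * (\<Prod>i = 0..<d. A x $$ (i, p i)))"
    by (intro sum mult const prod entry) (auto dest: permutes_in_image)
  then show ?thesis using det_def'[OF A] by simp
qed

lemma mat_mult_entry:
  assumes A: "\<And>x. A x \<in> carrier_mat n d" and B: "\<And>x. B x \<in> carrier_mat d m"
    and entries: "\<And>i j. i < n \<Longrightarrow> j < d \<Longrightarrow> S (\<lambda>x. A x $$ (i, j))"
      "\<And>i j. i < d \<Longrightarrow> j < m \<Longrightarrow> S (\<lambda>x. B x $$ (i, j))"
    and ij: "i < n" "j < m"
  shows "S (\<lambda>x. (A x * B x) $$ (i, j))"
proof -
  have "(A x * B x) $$ (i, j) = (\<Sum>k = 0..<d. A x $$ (i, k) * B x $$ (k, j))" for x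
    using carrier_matD[OF A[of x]] carrier_matD[OF B[of x]] ij by (simp add: scalar_prod_def)
  moreover have "S (\<lambda>x. \<Sum>k = 0..<d. A x $$ (i, k) * B x $$ (k, j))"
    by (intro sum mult entries ij) auto
  ultimately show ?thesis by simp
qed

lemma minor:
  assumes A: "\<And>x. A x \<in> carrier_mat n d" and I: "I \<subseteq> {..<n}" "card I = d"
    and entry: "\<And>i j. i < n \<Longrightarrow> j < d \<Longrightarrow> S (\<lambda>x. A x $$ (i, j))"
  shows "S (\<lambda>x. minor (A x) I)"
proof (rule det)
  show "submatrix (A x) I UNIV \<in> carrier_mat d d" for x by (rule submatrix_rows_carrier[OF A I])
  show "S (\<lambda>x. submatrix (A x) I UNIV $$ (i, j))" if "i < d" "j < d" for i j
    using entry[OF pick_less[OF I(1), of i] that(2)] that I(2) by (simp add: submatrix_rows[OF A I(1)])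
qed

lemma multihom:
  assumes "multihom ds n e P"
    and "\<And>i I. i < length ds \<Longrightarrow> I \<subseteq> {..<n} \<Longrightarrow> card I = ds ! i \<Longrightarrow> S (\<lambda>t. x t i I)"
  shows "S (\<lambda>t. P (x t))"
  using assms by induction (auto intro: const add mult)

end

definition polynomial_function :: "('k \<Rightarrow> 'k::field) \<Rightarrow> bool" where
  "polynomial_function f \<longleftrightarrow> (\<exists>p. f = poly p)"

interpretation polynomial_function: function_algebra "polynomial_function :: ('k \<Rightarrow> 'k::field) \<Rightarrow> bool"
proof
  show "polynomial_function (\<lambda>_. c)" for c :: 'k
    unfolding polynomial_function_def by (intro exI[of _ "[:c:]"]) auto
  show "polynomial_function (\<lambda>x. f x + g x)" if fg: "polynomial_function f" "polynomial_function g" for f g :: "'k \<Rightarrow> 'k"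
  proof -
    obtain p q where "f = poly p" "g = poly q" using fg unfolding polynomial_function_def by blast
    then have "(\<lambda>x. f x + g x) = poly (p + q)" by auto
    then show ?thesis unfolding polynomial_function_def by blast
  qed
  show "polynomial_function (\<lambda>x. f x * g x)" if fg: "polynomial_function f" "polynomial_function g" for f g :: "'k \<Rightarrow> 'k"
  proof -
    obtain p q where "f = poly p" "g = poly q" using fg unfolding polynomial_function_def by blast
    then have "(\<lambda>x. f x * g x) = poly (p * q)" by auto
    then show ?thesis unfolding polynomial_function_def by blast
  qed
qed

lemma polynomial_function_ident: "polynomial_function (\<lambda>t. t)"
  unfolding polynomial_function_def by (intro exI[of _ "[:0, 1:]"]) auto

text \<open>Over a finite field \<open>1 + (\<Prod>a. X - a)\<close> would have no root.\<close>

lemma infinite_UNIV_alg_closed: "infinite (UNIV :: 'k::alg_closed_field set)"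
proof
  assume fin: "finite (UNIV :: 'k set)"
  define p :: "'k poly" where "p = (\<Prod>a\<in>UNIV. [:- a, 1:]) + 1"
  have one: "poly p x = 1" for x
    unfolding p_def using fin by (simp add: poly_prod prod_zero_iff)
  have "degree (\<Prod>a\<in>(UNIV::'k set). [:- a, 1:]) = card (UNIV :: 'k set)"
    by (subst degree_prod_eq_sum_degree) auto
  moreover have "card (UNIV :: 'k set) > 0" using fin by (simp add: card_gt_0_iff)
  ultimately have "degree p > 0" unfolding p_def
    by (subst degree_add_eq_left) auto
  then obtain x where "poly p x = 0" using alg_closed_imp_poly_has_root by blast
  then show False using one by simp
qed

text \<open>Two nonempty open conditions on matrices have a common solution: restrict both to the line
  through a solution of the one and a solution of the other. There they are nonzero polynomials in
  one variable, with finitely many zeros in an infinite field. This is the form in which the irreducibility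
  of affine space enters.\<close>

lemma polynomial_functions_common_nonzero:
  fixes f g :: "'k::alg_closed_field \<Rightarrow> 'k"
  assumes "polynomial_function f" "polynomial_function g" "f s \<noteq> 0" "g t \<noteq> 0"
  obtains u where "f u \<noteq> 0" "g u \<noteq> 0"
proof -
  obtain p q where pq: "f = poly p" "g = poly q" using assms unfolding polynomial_function_def by blast
  then have "p * q \<noteq> 0" using assms by auto
  then have "finite {u. poly (p * q) u = 0}" by (rule poly_roots_finite)
  then obtain u where "poly (p * q) u \<noteq> 0"
    using infinite_UNIV_alg_closed by (metis (mono_tags, lifting) UNIV_eq_I mem_Collect_eq)
  then show ?thesis using that[of u] pq by simp
qed

section \<open>Products of Grassmannians\<close>

lemma listset_iff: "xs \<in> listset As \<longleftrightarrow> length xs = length As \<and> (\<forall>i<length As. xs ! i \<in> As ! i)"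
proof (induction As arbitrary: xs)
  case (Cons A As)
  then show ?case by (cases xs) (auto simp: set_Cons_def nth_Cons' less_Suc_eq_0_disj split: if_splits)
qed auto

lemma prod_grassmannian_iff:
  "Ws \<in> prod_grassmannian ds n \<longleftrightarrow>
     length Ws = length ds \<and> (\<forall>i<length ds. Ws ! i \<in> grassmannian (ds ! i) n)"
  unfolding prod_grassmannian_def listset_iff by auto

definition plucker :: "(nat \<Rightarrow> 'k::field mat) \<Rightarrow> nat \<Rightarrow> nat set \<Rightarrow> 'k" where
  "plucker M i I = minor (M i) I"

text \<open>Matrices are indexed by a function instead of a list, to be able to write them blockwise; the
  values from \<open>length ds\<close> on are arbitrary.\<close>

definition family :: "nat list \<Rightarrow> nat \<Rightarrow> (nat \<Rightarrow> 'k::field mat) \<Rightarrow> bool" where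
  "family ds n M \<longleftrightarrow> (\<forall>i<length ds. M i \<in> carrier_mat n (ds ! i))"

definition col_spaces :: "nat list \<Rightarrow> nat \<Rightarrow> (nat \<Rightarrow> 'k::field mat) \<Rightarrow> 'k vec set list" where
  "col_spaces ds n M = map (\<lambda>i. col_space n (M i)) [0..<length ds]"

lemma nth_col_spaces: "i < length ds \<Longrightarrow> col_spaces ds n M ! i = col_space n (M i)"
  by (simp add: col_spaces_def)

text \<open>Only the coordinates that occur in the generators of \<open>multihom\<close> are relevant to the value.\<close>

lemma multihom_cong:
  assumes "multihom ds n e P"
    and "\<And>i I. i < length ds \<Longrightarrow> I \<subseteq> {..<n} \<Longrightarrow> card I = ds ! i \<Longrightarrow> x i I = y i I"
  shows "P x = P y"
  using assms by induction auto

lemma multihom_scale: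
  assumes "multihom ds n e P"
  shows "P (\<lambda>i I. c i * x i I) = (\<Prod>i<length ds. c i ^ e i) * P x"
  using assms
proof induction
  case (var i I)
  have "(\<Prod>j<length ds. c j ^ (if j = i then 1 else 0)) = (\<Prod>j\<in>{i}. c j ^ (if j = i then 1 else 0))"
    using var by (intro prod.mono_neutral_right) auto
  then show ?case by simp
qed (simp_all add: algebra_simps power_add prod.distrib)

lemma plucker_coords_nonzero_iff:
  assumes P: "multihom ds n e P"
  shows "(\<exists>x\<in>plucker_coords ds n Ws. P x \<noteq> 0) \<longleftrightarrow>
    (\<exists>M. family ds n M \<and> (\<forall>i<length ds. col_space n (M i) = Ws ! i) \<and> P (plucker M) \<noteq> 0)"
proof
  assume "\<exists>x\<in>plucker_coords ds n Ws. P x \<noteq> 0"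
  then obtain As where "length As = length ds"
    "\<forall>i<length ds. As ! i \<in> carrier_mat n (ds ! i) \<and> col_space n (As ! i) = Ws ! i"
    "P (\<lambda>i I. minor (As ! i) I) \<noteq> 0"
    unfolding plucker_coords_def by auto
  then show "\<exists>M. family ds n M \<and> (\<forall>i<length ds. col_space n (M i) = Ws ! i) \<and> P (plucker M) \<noteq> 0"
    by (intro exI[of _ "\<lambda>i. As ! i"]) (auto simp: family_def plucker_def[abs_def])
next
  assume "\<exists>M. family ds n M \<and> (\<forall>i<length ds. col_space n (M i) = Ws ! i) \<and> P (plucker M) \<noteq> 0"
  then obtain M where M: "family ds n M" "\<forall>i<length ds. col_space n (M i) = Ws ! i" "P (plucker M) \<noteq> 0"
    by blast
  let ?As = "map M [0..<length ds]"
  have "P (\<lambda>i I. minor (?As ! i) I) = P (plucker M)"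
    by (rule multihom_cong[OF P]) (simp add: plucker_def)
  moreover have "(\<lambda>i I. minor (?As ! i) I) \<in> plucker_coords ds n Ws"
    unfolding plucker_coords_def using M(1,2) by (auto simp: family_def intro!: exI[of _ ?As])
  ultimately show "\<exists>x\<in>plucker_coords ds n Ws. P x \<noteq> 0"
    using M(3) by (intro bexI[of _ "\<lambda>i I. minor (?As ! i) I"]) simp_all
qed

lemma nonvanishing_locus_iff:
  assumes "multihom ds n e P"
  shows "Ws \<in> nonvanishing_locus ds n P \<longleftrightarrow> Ws \<in> prod_grassmannian ds n \<and>
    (\<exists>M. family ds n M \<and> (\<forall>i<length ds. col_space n (M i) = Ws ! i) \<and> P (plucker M) \<noteq> 0)"
  unfolding nonvanishing_locus_def using plucker_coords_nonzero_iff[OF assms] by auto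

lemma prod_grassmannian_matrices:
  assumes "Ws \<in> prod_grassmannian ds n"
  obtains M where "family ds n M" "\<And>i. i < length ds \<Longrightarrow> inj_mat (M i)"
    "\<And>i. i < length ds \<Longrightarrow> col_space n (M i) = Ws ! i"
proof -
  have "\<forall>i. \<exists>M. i < length ds \<longrightarrow> M \<in> carrier_mat n (ds ! i) \<and> inj_mat M \<and> col_space n M = Ws ! i"
    using assms unfolding prod_grassmannian_iff grassmannian_iff by blast
  then obtain M where "\<And>i. i < length ds \<Longrightarrow> M i \<in> carrier_mat n (ds ! i) \<and> inj_mat (M i) \<and> col_space n (M i) = Ws ! i"
    by metis
  then show ?thesis using that[of M] unfolding family_def by blast
qed

lemma col_spaces_in_prod_grassmannian:
  assumes "family ds n M" "\<And>i. i < length ds \<Longrightarrow> inj_mat (M i)"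
  shows "col_spaces ds n M \<in> prod_grassmannian ds n"
  using assms unfolding prod_grassmannian_iff grassmannian_iff family_def col_spaces_def by auto

text \<open>Plucker coordinates of the same point differ by nonzero scalars, so whether a multihomogeneous
  polynomial vanishes at a point does not depend on the matrices that represent it.\<close>

lemma multihom_nonzero_same_col_spaces:
  assumes P: "multihom ds n e P" and M: "family ds n M" and M': "family ds n M'"
    and inj: "\<And>i. i < length ds \<Longrightarrow> inj_mat (M' i)"
    and eq: "\<And>i. i < length ds \<Longrightarrow> col_space n (M i) = col_space n (M' i)"
    and nz: "P (plucker M) \<noteq> 0"
  shows "P (plucker M') \<noteq> 0"
proof -
  have "\<exists>G. G \<in> carrier_mat (ds ! i) (ds ! i) \<and> det G \<noteq> 0 \<and> M' i = M i * G" if i: "i < length ds" for i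
    using same_col_space[of "M i" n "ds ! i" "M' i"] M M' inj[OF i] eq[OF i] i
    unfolding family_def by metis
  then obtain G where G: "\<And>i. i < length ds \<Longrightarrow> G i \<in> carrier_mat (ds ! i) (ds ! i)"
    "\<And>i. i < length ds \<Longrightarrow> det (G i) \<noteq> 0" "\<And>i. i < length ds \<Longrightarrow> M' i = M i * G i"
    by metis
  have "P (plucker M') = P (\<lambda>i I. det (G i) * plucker M i I)"
  proof (rule multihom_cong[OF P])
    fix i I assume i: "i < length ds" and I: "I \<subseteq> {..<n}" "card I = ds ! i"
    have "minor (M i * G i) I = minor (M i) I * det (G i)"
      using M i unfolding family_def by (intro minor_mult[OF _ G(1)[OF i] I]) auto
    then show "plucker M' i I = det (G i) * plucker M i I" using G(3)[OF i] by (simp add: plucker_def)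
  qed
  also have "\<dots> = (\<Prod>i<length ds. det (G i) ^ e i) * P (plucker M)" by (rule multihom_scale[OF P])
  finally show ?thesis using nz G(2) by (simp add: prod_zero_iff)
qed

text \<open>The inclusion from right to left needs one tuple of matrices at which both polynomials are
  nonzero, hence the independence of the representing matrices.\<close>

lemma nonvanishing_locus_mult:
  assumes P: "multihom ds n e P" and Q: "multihom ds n e' Q"
  shows "nonvanishing_locus ds n (\<lambda>x. P x * Q x) = nonvanishing_locus ds n P \<inter> nonvanishing_locus ds n Q"
proof (intro equalityI subsetI)
  fix Ws assume "Ws \<in> nonvanishing_locus ds n (\<lambda>x. P x * Q x)"
  then show "Ws \<in> nonvanishing_locus ds n P \<inter> nonvanishing_locus ds n Q"
    unfolding nonvanishing_locus_def by auto
next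
  fix Ws assume Ws: "Ws \<in> nonvanishing_locus ds n P \<inter> nonvanishing_locus ds n Q"
  then have "Ws \<in> prod_grassmannian ds n" unfolding nonvanishing_locus_def by auto
  then obtain M where M: "family ds n M" "\<And>i. i < length ds \<Longrightarrow> inj_mat (M i)"
    "\<And>i. i < length ds \<Longrightarrow> col_space n (M i) = Ws ! i"
    by (rule prod_grassmannian_matrices) blast
  have "P (plucker M) \<noteq> 0"
    using Ws multihom_nonzero_same_col_spaces[OF P _ M(1,2)] M(3) nonvanishing_locus_iff[OF P] by auto
  moreover have "Q (plucker M) \<noteq> 0"
    using Ws multihom_nonzero_same_col_spaces[OF Q _ M(1,2)] M(3) nonvanishing_locus_iff[OF Q] by auto
  ultimately show "Ws \<in> nonvanishing_locus ds n (\<lambda>x. P x * Q x)"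
    unfolding nonvanishing_locus_iff[OF multihom.mult[OF P Q]] using M \<open>Ws \<in> prod_grassmannian ds n\<close> by auto
qed

lemma nonvanishing_locus_one: "nonvanishing_locus ds n (\<lambda>_. 1) = (prod_grassmannian ds n :: 'k::field vec set list set)"
proof (intro equalityI subsetI)
  fix Ws :: "'k vec set list" assume Ws: "Ws \<in> prod_grassmannian ds n"
  then show "Ws \<in> nonvanishing_locus ds n (\<lambda>_. 1)"
    unfolding nonvanishing_locus_iff[OF multihom.const]
    using prod_grassmannian_matrices[OF Ws] by (metis zero_neq_one)
qed (simp add: nonvanishing_locus_def)

lemma nonvanishing_locus_subset: "nonvanishing_locus ds n P \<subseteq> prod_grassmannian ds n"
  unfolding nonvanishing_locus_def by auto

lemma topspace_zariski: "topspace (zariski ds n) = (prod_grassmannian ds n :: 'k::field vec set list set)"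
proof -
  have "nonvanishing_locus ds n (\<lambda>_. 1 :: 'k) \<in> {nonvanishing_locus ds n P | e P. multihom ds n e P}"
    using multihom.const by blast
  then show ?thesis unfolding zariski_def topology_generated_by_topspace
    using nonvanishing_locus_one nonvanishing_locus_subset by blast
qed

text \<open>The generating sets are closed under intersection, so they form a basis of the topology, and
  density can be tested on them.\<close>

lemma zariski_open_contains_basic:
  assumes "openin (zariski ds n) U" "Ws \<in> (U :: 'k::field vec set list set)"
  shows "\<exists>e P. multihom ds n e P \<and> Ws \<in> nonvanishing_locus ds n P \<and> nonvanishing_locus ds n P \<subseteq> U"
proof -
  have "generate_topology_on {nonvanishing_locus ds n P | e P. multihom ds n e P} U"
    using assms(1) unfolding zariski_def openin_topology_generated_by_iff .
  then show ?thesis using assms(2)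
  proof induction
    case (Int a b)
    obtain e P where P: "multihom ds n e P" "Ws \<in> nonvanishing_locus ds n P" "nonvanishing_locus ds n P \<subseteq> a"
      using Int.IH(1) Int.prems by blast
    obtain e' Q where Q: "multihom ds n e' Q" "Ws \<in> nonvanishing_locus ds n Q" "nonvanishing_locus ds n Q \<subseteq> b"
      using Int.IH(2) Int.prems by blast
    have "Ws \<in> nonvanishing_locus ds n (\<lambda>x. P x * Q x)" "nonvanishing_locus ds n (\<lambda>x. P x * Q x) \<subseteq> a \<inter> b"
      unfolding nonvanishing_locus_mult[OF P(1) Q(1)] using P(2,3) Q(2,3) by auto
    then show ?case using multihom.mult[OF P(1) Q(1)] by blast
  next
    case (UN K)
    then obtain k where k: "k \<in> K" "Ws \<in> k" by blast
    then obtain e P where "multihom ds n e P" "Ws \<in> nonvanishing_locus ds n P" "nonvanishing_locus ds n P \<subseteq> k"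
      using UN.IH by blast
    then show ?case using k by blast
  next
    case (Basis U)
    then show ?case by blast
  qed simp
qed

lemma zariski_dense_iff:
  fixes D :: "'k::field vec set list set"
  shows "zariski ds n closure_of D = prod_grassmannian ds n \<longleftrightarrow>
    (\<forall>e P. multihom ds n e P \<longrightarrow> nonvanishing_locus ds n P \<noteq> {} \<longrightarrow> nonvanishing_locus ds n P \<inter> D \<noteq> {})"
proof
  assume dense: "zariski ds n closure_of D = prod_grassmannian ds n"
  show "\<forall>e P. multihom ds n e P \<longrightarrow> nonvanishing_locus ds n P \<noteq> {} \<longrightarrow> nonvanishing_locus ds n P \<inter> D \<noteq> {}"
  proof (intro allI impI)
    fix e and P :: "(nat \<Rightarrow> nat set \<Rightarrow> 'k) \<Rightarrow> 'k" assume P: "multihom ds n e P" "nonvanishing_locus ds n P \<noteq> {}"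
    then obtain Ws where Ws: "Ws \<in> nonvanishing_locus ds n P" by blast
    have "openin (zariski ds n) (nonvanishing_locus ds n P)"
      unfolding zariski_def by (rule topology_generated_by_Basis) (use P in blast)
    moreover have "Ws \<in> zariski ds n closure_of D" using Ws nonvanishing_locus_subset dense by blast
    ultimately show "nonvanishing_locus ds n P \<inter> D \<noteq> {}" using Ws unfolding in_closure_of by blast
  qed
next
  assume R: "\<forall>e P. multihom ds n e P \<longrightarrow> nonvanishing_locus ds n P \<noteq> {} \<longrightarrow> nonvanishing_locus ds n P \<inter> D \<noteq> {}"
  show "zariski ds n closure_of D = prod_grassmannian ds n"
  proof
    show "zariski ds n closure_of D \<subseteq> prod_grassmannian ds n"
      using closure_of_subset_topspace topspace_zariski by metis
    show "prod_grassmannian ds n \<subseteq> zariski ds n closure_of D"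
    proof
      fix Ws :: "'k vec set list" assume Ws: "Ws \<in> prod_grassmannian ds n"
      show "Ws \<in> zariski ds n closure_of D"
        unfolding in_closure_of topspace_zariski
      proof (intro conjI allI impI)
        fix U assume "Ws \<in> U \<and> openin (zariski ds n) U"
        then obtain e P where "multihom ds n e P" "Ws \<in> nonvanishing_locus ds n P" "nonvanishing_locus ds n P \<subseteq> U"
          using zariski_open_contains_basic by blast
        then show "\<exists>y. y \<in> D \<and> y \<in> U" using R by blast
      qed (rule Ws)
    qed
  qed
qed

section \<open>Block decompositions\<close>

text \<open>Coordinates of \<open>n\<close>-space are labelled by pairs of a block \<open>i\<close> and a position in the block of
  size \<open>as ! i\<close>. The blocks are only ever addressed through the labels, so an arbitrary
  bijection, which exists by counting, serves as well as the lexicographic one.\<close>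

locale block_index =
  fixes as :: "nat list" and n :: nat and blk :: "nat \<Rightarrow> nat \<times> nat"
  assumes bij: "bij_betw blk {..<n} (SIGMA i:{..<length as}. {..<as ! i})"
begin

definition pos :: "nat \<times> nat \<Rightarrow> nat" where
  "pos = the_inv_into {..<n} blk"

lemma blk_less:
  assumes "p < n"
  shows "fst (blk p) < length as" "snd (blk p) < as ! fst (blk p)"
proof -
  have "blk p \<in> (SIGMA i:{..<length as}. {..<as ! i})" using bij_betwE[OF bij] assms by blast
  then show "fst (blk p) < length as" "snd (blk p) < as ! fst (blk p)" by auto
qed

lemma pos_less: "i < length as \<Longrightarrow> s < as ! i \<Longrightarrow> pos (i, s) < n"
  using bij_betwE[OF bij_betw_the_inv_into[OF bij]] unfolding pos_def by auto

lemma blk_pos: "i < length as \<Longrightarrow> s < as ! i \<Longrightarrow> blk (pos (i, s)) = (i, s)"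
  unfolding pos_def by (rule f_the_inv_into_f_bij_betw[OF bij]) auto

lemma pos_blk: "p < n \<Longrightarrow> pos (blk p) = p"
  unfolding pos_def using bij by (intro the_inv_into_f_f) (auto simp: bij_betw_def)

lemma sum_over_block:
  fixes g :: "nat \<Rightarrow> 'k::field"
  assumes i: "i < length as"
  shows "(\<Sum>p = 0..<n. if fst (blk p) = i then g (snd (blk p)) else 0) = (\<Sum>s = 0..<as ! i. g s)"
proof -
  have "(\<Sum>p = 0..<n. if fst (blk p) = i then g (snd (blk p)) else 0)
      = (\<Sum>p\<in>{p\<in>{0..<n}. fst (blk p) = i}. g (snd (blk p)))"
    by (rule sum.inter_filter[symmetric]) simp
  also have "\<dots> = (\<Sum>s = 0..<as ! i. g s)"
    by (rule sum.reindex_bij_witness[of _ "\<lambda>s. pos (i, s)" "\<lambda>p. snd (blk p)"])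
       (use i blk_less pos_blk blk_pos pos_less in auto)
  finally show ?thesis .
qed

definition inclusion :: "nat \<Rightarrow> 'k::field mat" where
  "inclusion i = mat n (as ! i) (\<lambda>(p, q). if blk p = (i, q) then 1 else 0)"

text \<open>The blocks of rows are the transposes of the \<open>K i\<close>, so that their row spaces are column spaces,
  that is, points of Grassmannians of \<open>b\<close>-space.\<close>

definition stack :: "nat \<Rightarrow> (nat \<Rightarrow> 'k::field mat) \<Rightarrow> 'k mat" where
  "stack b K = mat n b (\<lambda>(p, q). K (fst (blk p)) $$ (q, snd (blk p)))"

definition unstack :: "nat \<Rightarrow> 'k::field mat \<Rightarrow> nat \<Rightarrow> 'k mat" where
  "unstack b X i = mat b (as ! i) (\<lambda>(q, s). X $$ (pos (i, s), q))"

text \<open>The transposes match those in \<open>stack\<close>: multiplying \<open>stack b K\<close> from the left by this matrix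
  replaces \<open>K i\<close> by \<open>K i * D i\<close>, the change of basis in a column space.\<close>

definition block_diag :: "(nat \<Rightarrow> 'k::field mat) \<Rightarrow> 'k mat" where
  "block_diag D = mat n n (\<lambda>(p, q).
     if fst (blk q) = fst (blk p) then D (fst (blk p)) $$ (snd (blk q), snd (blk p)) else 0)"

lemma carrier_blocks [simp]:
  "inclusion i \<in> carrier_mat n (as ! i)" "stack b K \<in> carrier_mat n b"
  "unstack b X i \<in> carrier_mat b (as ! i)" "block_diag D \<in> carrier_mat n n"
  by (simp_all add: inclusion_def stack_def unstack_def block_diag_def)

lemma dims_blocks [simp]:
  "dim_row (inclusion i) = n" "dim_col (inclusion i) = as ! i"
  "dim_row (stack b K) = n" "dim_col (stack b K) = b"
  "dim_row (block_diag D) = n" "dim_col (block_diag D) = n"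
  by (simp_all add: inclusion_def stack_def block_diag_def)

lemma stack_unstack: "X \<in> carrier_mat n b \<Longrightarrow> stack b (unstack b X) = X"
  by (rule eq_matI) (auto simp: stack_def unstack_def blk_less pos_blk)

lemma unstack_stack: "i < length as \<Longrightarrow> K i \<in> carrier_mat b (as ! i) \<Longrightarrow> unstack b (stack b K) i = K i"
  by (rule eq_matI) (auto simp: stack_def unstack_def blk_pos pos_less)

lemma stack_cong: "(\<And>i. i < length as \<Longrightarrow> K i = L i) \<Longrightarrow> stack b K = stack b L"
  by (rule eq_matI) (auto simp: stack_def blk_less)

lemma mult_inclusion:
  fixes A :: "'k::field mat"
  assumes A: "A \<in> carrier_mat n n" and i: "i < length as"
  shows "A * inclusion i = mat n (as ! i) (\<lambda>(p, q). A $$ (p, pos (i, q)))"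
proof (rule eq_matI)
  fix p q
  assume "p < dim_row (mat n (as ! i) (\<lambda>(p, q). A $$ (p, pos (i, q))))"
    and "q < dim_col (mat n (as ! i) (\<lambda>(p, q). A $$ (p, pos (i, q))))"
  then have p: "p < n" and q: "q < as ! i" by auto
  have eq: "(blk k = (i, q)) = (k = pos (i, q))" if "k < n" for k
    using pos_blk[OF that] blk_pos[OF i q] by metis
  have "(A * inclusion i) $$ (p, q) = (\<Sum>k = 0..<n. A $$ (p, k) * (if blk k = (i, q) then 1 else 0))"
    using A p q by (simp add: inclusion_def scalar_prod_def)
  also have "\<dots> = (\<Sum>k = 0..<n. if k = pos (i, q) then A $$ (p, k) else 0)"
    using eq by (intro sum.cong) auto
  also have "\<dots> = A $$ (p, pos (i, q))" using pos_less[OF i q] by simp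
  finally show "(A * inclusion i) $$ (p, q) = mat n (as ! i) (\<lambda>(p, q). A $$ (p, pos (i, q))) $$ (p, q)"
    using p q by simp
qed (use A in auto)

lemma inj_mat_inclusion:
  assumes i: "i < length as"
  shows "inj_mat (inclusion i :: 'k::field mat)"
  unfolding inj_mat_def
proof (intro ballI impI)
  fix v :: "'k vec"
  assume v: "v \<in> carrier_vec (dim_col (inclusion i :: 'k mat))"
    and zero: "inclusion i *\<^sub>v v = 0\<^sub>v (dim_row (inclusion i :: 'k mat))"
  show "v = 0\<^sub>v (dim_col (inclusion i :: 'k mat))"
  proof (rule eq_vecI)
    fix q assume "q < dim_vec (0\<^sub>v (dim_col (inclusion i :: 'k mat)) :: 'k vec)"
    then have q: "q < as ! i" by simp
    have "(inclusion i *\<^sub>v v) $ pos (i, q) = (\<Sum>k = 0..<as ! i. (if q = k then 1 else 0) * v $ k)"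
      using v pos_less[OF i q] blk_pos[OF i q] by (simp add: inclusion_def scalar_prod_def)
    also have "\<dots> = (\<Sum>k = 0..<as ! i. if q = k then v $ k else 0)"
      by (rule sum.cong) auto
    also have "\<dots> = v $ q" using q by simp
    finally show "v $ q = 0\<^sub>v (dim_col (inclusion i :: 'k mat)) $ q"
      using zero q pos_less[OF i q] by simp
  qed (use v in auto)
qed

text \<open>The factor on the right only changes the basis of the column space, so block diagonal matrices
  stabilise the coordinate blocks.\<close>

lemma block_diag_mult_inclusion:
  fixes D :: "nat \<Rightarrow> 'k::field mat"
  assumes i: "i < length as" and D: "D i \<in> carrier_mat (as ! i) (as ! i)"
  shows "block_diag D * inclusion i = inclusion i * (D i)\<^sup>T"
proof (rule eq_matI)
  fix p q
  assume "p < dim_row (inclusion i * (D i)\<^sup>T)" "q < dim_col (inclusion i * (D i)\<^sup>T)"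
  then have p: "p < n" and q: "q < as ! i" using D by auto
  have "(inclusion i * (D i)\<^sup>T) $$ (p, q)
      = (\<Sum>k = 0..<as ! i. (if blk p = (i, k) then 1 else 0) * D i $$ (q, k))"
    using D p q by (simp add: inclusion_def scalar_prod_def)
  also have "\<dots> = (\<Sum>k = 0..<as ! i. if snd (blk p) = k then (if fst (blk p) = i then D i $$ (q, k) else 0) else 0)"
    by (intro sum.cong) (auto simp: prod_eq_iff)
  also have "\<dots> = (if fst (blk p) = i then D i $$ (q, snd (blk p)) else 0)"
    using blk_less[OF p] by auto
  finally show "(block_diag D * inclusion i) $$ (p, q) = (inclusion i * (D i)\<^sup>T) $$ (p, q)"
    using p q blk_pos[OF i q] pos_less[OF i q]
    by (subst mult_inclusion[OF _ i]) (auto simp: block_diag_def)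
qed (use D in auto)

lemma block_diag_mult_stack:
  fixes D :: "nat \<Rightarrow> 'k::field mat"
  assumes D: "\<And>i. i < length as \<Longrightarrow> D i \<in> carrier_mat (as ! i) (as ! i)"
    and K: "\<And>i. i < length as \<Longrightarrow> K i \<in> carrier_mat b (as ! i)"
  shows "block_diag D * stack b K = stack b (\<lambda>i. K i * D i)"
proof (rule eq_matI)
  fix p q assume "p < dim_row (stack b (\<lambda>i. K i * D i))" "q < dim_col (stack b (\<lambda>i. K i * D i))"
  then have p: "p < n" and q: "q < b" by auto
  define i s where "i = fst (blk p)" and "s = snd (blk p)"
  have i: "i < length as" and s: "s < as ! i" using blk_less[OF p] unfolding i_def s_def by auto
  have "(block_diag D * stack b K) $$ (p, q) =
      (\<Sum>k = 0..<n. if fst (blk k) = i then D i $$ (snd (blk k), s) * K i $$ (q, snd (blk k)) else 0)"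
    using p q unfolding i_def s_def
    by (auto simp: block_diag_def stack_def scalar_prod_def intro!: sum.cong)
  also have "\<dots> = (\<Sum>t = 0..<as ! i. D i $$ (t, s) * K i $$ (q, t))" by (rule sum_over_block[OF i])
  also have "\<dots> = (K i * D i) $$ (q, s)"
    using D[OF i] K[OF i] q s by (auto simp: scalar_prod_def intro!: sum.cong)
  finally show "(block_diag D * stack b K) $$ (p, q) = stack b (\<lambda>i. K i * D i) $$ (p, q)"
    using p q unfolding i_def s_def by (simp add: stack_def)
qed auto

lemma block_diag_mult:
  fixes D :: "nat \<Rightarrow> 'k::field mat"
  assumes D: "\<And>i. i < length as \<Longrightarrow> D i \<in> carrier_mat (as ! i) (as ! i)"
    and E: "\<And>i. i < length as \<Longrightarrow> E i \<in> carrier_mat (as ! i) (as ! i)"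
  shows "block_diag D * block_diag E = block_diag (\<lambda>i. E i * D i)"
proof (rule eq_matI)
  fix p q assume "p < dim_row (block_diag (\<lambda>i. E i * D i))" "q < dim_col (block_diag (\<lambda>i. E i * D i))"
  then have p: "p < n" and q: "q < n" by auto
  define i s where "i = fst (blk p)" and "s = snd (blk p)"
  define j u where "j = fst (blk q)" and "u = snd (blk q)"
  have i: "i < length as" and s: "s < as ! i" using blk_less[OF p] unfolding i_def s_def by auto
  have u: "u < as ! j" using blk_less[OF q] unfolding j_def u_def by auto
  have "(block_diag D * block_diag E) $$ (p, q) =
      (\<Sum>k = 0..<n. if fst (blk k) = i then D i $$ (snd (blk k), s) * (if j = i then E i $$ (u, snd (blk k)) else 0) else 0)"
    using p q unfolding i_def s_def j_def u_def
    by (auto simp: block_diag_def scalar_prod_def intro!: sum.cong)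
  also have "\<dots> = (\<Sum>t = 0..<as ! i. D i $$ (t, s) * (if j = i then E i $$ (u, t) else 0))"
    by (rule sum_over_block[OF i])
  also have "\<dots> = (if j = i then (E i * D i) $$ (u, s) else 0)"
    using D[OF i] E[OF i] u s by (auto simp: scalar_prod_def intro!: sum.cong)
  finally show "(block_diag D * block_diag E) $$ (p, q) = block_diag (\<lambda>i. E i * D i) $$ (p, q)"
    using p q unfolding i_def s_def j_def u_def by (simp add: block_diag_def)
qed auto

lemma det_block_diag_nonzero:
  fixes D :: "nat \<Rightarrow> 'k::field mat"
  assumes D: "\<And>i. i < length as \<Longrightarrow> D i \<in> carrier_mat (as ! i) (as ! i)"
    and det: "\<And>i. i < length as \<Longrightarrow> det (D i) \<noteq> 0"
  shows "det (block_diag D) \<noteq> 0"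
proof -
  have "\<exists>E. E \<in> carrier_mat (as ! i) (as ! i) \<and> E * D i = 1\<^sub>m (as ! i)" if i: "i < length as" for i
    using det_nonzero_inverse[OF D[OF i] det[OF i]] by metis
  then obtain E where E: "\<And>i. i < length as \<Longrightarrow> E i \<in> carrier_mat (as ! i) (as ! i)"
    "\<And>i. i < length as \<Longrightarrow> E i * D i = 1\<^sub>m (as ! i)"
    by metis
  have "block_diag D * block_diag E = block_diag (\<lambda>i. E i * D i)"
    using D E(1) by (rule block_diag_mult)
  also have "\<dots> = 1\<^sub>m n"
  proof (rule eq_matI)
    fix p q assume "p < dim_row (1\<^sub>m n :: 'k mat)" "q < dim_col (1\<^sub>m n :: 'k mat)"
    then have p: "p < n" and q: "q < n" by auto
    have "(p = q) = (blk p = blk q)" using pos_blk p q by metis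
    then show "block_diag (\<lambda>i. E i * D i) $$ (p, q) = (1\<^sub>m n :: 'k mat) $$ (p, q)"
      using p q E(2)[OF blk_less(1)[OF p]] blk_less[OF p] blk_less[OF q]
      by (auto simp: block_diag_def prod_eq_iff)
  qed auto
  finally have "det (block_diag D) * det (block_diag E) = 1"
    using det_mult[of "block_diag D" n "block_diag E"] by simp
  then show ?thesis by auto
qed

text \<open>A change of basis of the column space of \<open>stack b K\<close> is the diagonal action of \<open>GL(b)\<close> on
  the column spaces of the \<open>K i\<close>.\<close>

lemma stack_mult:
  fixes h :: "'k::field mat"
  assumes h: "h \<in> carrier_mat b b" and K: "\<And>i. i < length as \<Longrightarrow> K i \<in> carrier_mat b (as ! i)"
  shows "stack b K * h = stack b (\<lambda>i. h\<^sup>T * K i)"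
proof (rule eq_matI)
  fix p q assume "p < dim_row (stack b (\<lambda>i. h\<^sup>T * K i))" "q < dim_col (stack b (\<lambda>i. h\<^sup>T * K i))"
  then have p: "p < n" and q: "q < b" by auto
  show "(stack b K * h) $$ (p, q) = stack b (\<lambda>i. h\<^sup>T * K i) $$ (p, q)"
    using p q h K[OF blk_less(1)[OF p]] blk_less[OF p]
    by (auto simp: stack_def scalar_prod_def intro!: sum.cong)
qed (use h in auto)

end

section \<open>Homogenisation in the Pluecker coordinates\<close>

lemma multihom_prod:
  assumes "finite I" "\<And>i. i \<in> I \<Longrightarrow> multihom ds n (e i) (P i)"
  shows "multihom ds n (\<lambda>j. \<Sum>i\<in>I. e i j) (\<lambda>x. \<Prod>i\<in>I. P i x)"
  using assms by (induction I) (auto intro: multihom.const multihom.mult)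

lemma multihom_power:
  assumes "multihom ds n e P"
  shows "multihom ds n (\<lambda>j. m * e j) (\<lambda>x. P x ^ m)"
proof -
  have "multihom ds n (\<lambda>j. \<Sum>i\<in>{..<m}. e j) (\<lambda>x. \<Prod>i\<in>{..<m}. P x)"
    using assms by (intro multihom_prod) auto
  then show ?thesis by simp
qed

lemma multihom_degree_cong:
  assumes "multihom ds n e P" "\<And>j. e j = e' j"
  shows "multihom ds n e' P"
proof -
  have "e = e'" using assms(2) by auto
  then show ?thesis using assms(1) by simp
qed

text \<open>Where \<open>chart\<close> is nonzero, every subspace is the graph of a linear map from the first
  \<open>ds ! i\<close> coordinates and has a unique basis matrix with an identity block on top.\<close>

definition chart :: "nat list \<Rightarrow> (nat \<Rightarrow> nat set \<Rightarrow> 'k::field) \<Rightarrow> 'k" where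
  "chart ds x = (\<Prod>i<length ds. x i {..<ds ! i})"

text \<open>The same exponent \<open>m\<close> is used for all factors: then two such functions are brought to a
  common degree by multiplication with a power of \<open>chart\<close>, and sums stay in the class.\<close>

definition homogenisable :: "nat list \<Rightarrow> nat \<Rightarrow> ((nat \<Rightarrow> nat set \<Rightarrow> 'k::field) \<Rightarrow> 'k) \<Rightarrow> bool" where
  "homogenisable ds n f \<longleftrightarrow> (\<exists>m Q. multihom ds n (\<lambda>j. if j < length ds then m else 0) Q \<and>
     (\<forall>x. chart ds x \<noteq> 0 \<longrightarrow> Q x = chart ds x ^ m * f x))"

lemma multihom_chart_power:
  assumes "\<And>i. i < length ds \<Longrightarrow> ds ! i \<le> n"
  shows "multihom ds n (\<lambda>j. if j < length ds then m else 0) (\<lambda>x. chart ds x ^ m)"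
proof -
  have "multihom ds n (\<lambda>j. \<Sum>i\<in>{..<length ds}. if j = i then 1 else 0) (\<lambda>x. \<Prod>i\<in>{..<length ds}. x i {..<ds ! i})"
    using assms by (intro multihom_prod multihom.var) auto
  from multihom_power[OF this, of m] show ?thesis
    unfolding chart_def by (rule multihom_degree_cong) auto
qed

lemma function_algebra_homogenisable:
  assumes le: "\<And>i. i < length ds \<Longrightarrow> ds ! i \<le> n"
  shows "function_algebra (homogenisable ds n :: ((nat \<Rightarrow> nat set \<Rightarrow> 'k::field) \<Rightarrow> 'k) \<Rightarrow> bool)"
proof
  let ?e = "\<lambda>m j. if j < length ds then m else (0::nat)"
  show "homogenisable ds n (\<lambda>_. c)" for c :: 'k
  proof -
    have "multihom ds n (?e 0) (\<lambda>_. c)" by (rule multihom_degree_cong[OF multihom.const]) auto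
    then show ?thesis unfolding homogenisable_def by (intro exI[of _ 0] exI[of _ "\<lambda>_. c"]) simp
  qed
  fix f g :: "(nat \<Rightarrow> nat set \<Rightarrow> 'k) \<Rightarrow> 'k"
  assume "homogenisable ds n f" "homogenisable ds n g"
  then obtain m Q m' Q' where Q: "multihom ds n (?e m) Q" "\<And>x. chart ds x \<noteq> 0 \<Longrightarrow> Q x = chart ds x ^ m * f x"
    and Q': "multihom ds n (?e m') Q'" "\<And>x. chart ds x \<noteq> 0 \<Longrightarrow> Q' x = chart ds x ^ m' * g x"
    unfolding homogenisable_def by blast
  have "multihom ds n (?e (m + m')) (\<lambda>x. Q x * chart ds x ^ m')"
    by (rule multihom_degree_cong[OF multihom.mult[OF Q(1) multihom_chart_power[OF le]]]) auto
  moreover have "multihom ds n (?e (m + m')) (\<lambda>x. Q' x * chart ds x ^ m)"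
    by (rule multihom_degree_cong[OF multihom.mult[OF Q'(1) multihom_chart_power[OF le]]]) auto
  ultimately have "multihom ds n (?e (m + m')) (\<lambda>x. Q x * chart ds x ^ m' + Q' x * chart ds x ^ m)"
    by (rule multihom.add)
  then show "homogenisable ds n (\<lambda>x. f x + g x)"
    unfolding homogenisable_def
    by (intro exI[of _ "m + m'"] exI conjI, assumption) (simp add: Q(2) Q'(2) power_add algebra_simps)
  have "multihom ds n (?e (m + m')) (\<lambda>x. Q x * Q' x)"
    by (rule multihom_degree_cong[OF multihom.mult[OF Q(1) Q'(1)]]) auto
  then show "homogenisable ds n (\<lambda>x. f x * g x)"
    unfolding homogenisable_def
    by (intro exI[of _ "m + m'"] exI conjI, assumption) (simp add: Q(2) Q'(2) power_add algebra_simps)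
qed

text \<open>To clear the denominator \<open>x i {..<ds ! i}\<close> with a power of the whole \<open>chart\<close>, the leading
  coordinates of the other factors are multiplied in.\<close>

lemma homogenisable_coordinate_quotient:
  assumes le: "\<And>i. i < length ds \<Longrightarrow> ds ! i \<le> n"
    and i: "i < length ds" and I: "I \<subseteq> {..<n}" "card I = ds ! i"
  shows "homogenisable ds n (\<lambda>x. x i I / x i {..<ds ! i})"
proof -
  let ?J = "{..<length ds} - {i}"
  have "multihom ds n (\<lambda>j. (if j = i then 1 else 0) + (\<Sum>k\<in>?J. if j = k then 1 else 0))
      (\<lambda>x. x i I * (\<Prod>k\<in>?J. x k {..<ds ! k}))"
    using le i I by (intro multihom.mult multihom_prod multihom.var) auto
  then have "multihom ds n (\<lambda>j. if j < length ds then 1 else 0) (\<lambda>x. x i I * (\<Prod>k\<in>?J. x k {..<ds ! k}))"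
    by (rule multihom_degree_cong) (use i in auto)
  moreover have "x i I * (\<Prod>k\<in>?J. x k {..<ds ! k}) = chart ds x ^ 1 * (x i I / x i {..<ds ! i})"
    if "chart ds x \<noteq> 0" for x
  proof -
    have "chart ds x = x i {..<ds ! i} * (\<Prod>k\<in>?J. x k {..<ds ! k})"
      unfolding chart_def using i by (intro prod.remove) auto
    then show ?thesis using that by auto
  qed
  ultimately show ?thesis unfolding homogenisable_def by blast
qed

lemma pick_lessThan: "i < a \<Longrightarrow> pick {..<a} i = i"
proof -
  assume i: "i < a"
  have "{x \<in> {..<a}. x < i} = {..<i}" using i by auto
  then show ?thesis using pick_card_in_set[of i "{..<a}"] i by simp
qed

lemma submatrix_top:
  assumes "M \<in> carrier_mat n d" "d \<le> n"
  shows "submatrix M {..<d} UNIV = mat d d (\<lambda>(i, j). M $$ (i, j))"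
  using submatrix_rows[OF assms(1), of "{..<d}"] assms(2)
  by (auto intro!: eq_matI simp: pick_lessThan)

text \<open>The section of the quotient by the base changes that the transfer of density needs: from the
  Pluecker coordinates alone it recovers \<open>K i\<close> up to its own top block, with entries that are
  homogenisable. A polynomial in matrices thereby pulls back to a multihomogeneous polynomial on the
  product of Grassmannians.\<close>

lemma normal_form_of_plucker_coordinates:
  assumes le: "\<And>i. i < length ds \<Longrightarrow> ds ! i \<le> n"
  obtains N :: "(nat \<Rightarrow> nat set \<Rightarrow> 'k::field) \<Rightarrow> nat \<Rightarrow> 'k mat" where
    "\<And>x i. N x i \<in> carrier_mat n (ds ! i)"
    "\<And>i l s. i < length ds \<Longrightarrow> l < n \<Longrightarrow> s < ds ! i \<Longrightarrow> homogenisable ds n (\<lambda>x. N x i $$ (l, s))"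
    "\<And>K i. family ds n K \<Longrightarrow> i < length ds \<Longrightarrow> minor (K i) {..<ds ! i} \<noteq> 0 \<Longrightarrow>
       K i = N (plucker K) i * submatrix (K i) {..<ds ! i} UNIV"
proof -
  define R where "R i l s c I \<longleftrightarrow> I \<subseteq> {..<n} \<and> card I = ds ! i \<and>
      (\<forall>M\<in>carrier_mat n (ds ! i).
        det (mat (ds ! i) (ds ! i) (\<lambda>(k, j). M $$ ((id(s := l)) k, j))) = c * minor M I)"
    for i l s I and c :: 'k
  have "\<exists>c I. R i l s c I" if "i < length ds" "l < n" for i l s
  proof -
    have "(id(s := l)) k < n" if "k < ds ! i" for k
      using \<open>l < n\<close> le[OF \<open>i < length ds\<close>] that by simp
    from det_rows_eq_minor[OF this le[OF that(1)]] show ?thesis unfolding R_def .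
  qed
  then obtain c I where R: "\<And>i l s. i < length ds \<Longrightarrow> l < n \<Longrightarrow> R i l s (c i l s) (I i l s)"
    by metis
  then have cI: "\<And>i l s. i < length ds \<Longrightarrow> l < n \<Longrightarrow> I i l s \<subseteq> {..<n}"
    "\<And>i l s. i < length ds \<Longrightarrow> l < n \<Longrightarrow> card (I i l s) = ds ! i"
    "\<And>i l s M. i < length ds \<Longrightarrow> l < n \<Longrightarrow> M \<in> carrier_mat n (ds ! i) \<Longrightarrow>
      det (mat (ds ! i) (ds ! i) (\<lambda>(k, j). M $$ ((id(s := l)) k, j))) = c i l s * minor M (I i l s)"
    unfolding R_def by blast+
  define N where "N x i = mat n (ds ! i) (\<lambda>(l, s). c i l s * (x i (I i l s) / x i {..<ds ! i}))"
    for x :: "nat \<Rightarrow> nat set \<Rightarrow> 'k" and i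
  interpret function_algebra "homogenisable ds n :: ((nat \<Rightarrow> nat set \<Rightarrow> 'k) \<Rightarrow> 'k) \<Rightarrow> bool"
    by (rule function_algebra_homogenisable[OF le])
  show ?thesis
  proof (rule that[of N])
    show "N x i \<in> carrier_mat n (ds ! i)" for x i unfolding N_def by simp
    show "homogenisable ds n (\<lambda>x. N x i $$ (l, s))" if "i < length ds" "l < n" "s < ds ! i" for i l s
    proof -
      have "homogenisable ds n (\<lambda>x. c i l s * (x i (I i l s) / x i {..<ds ! i}))"
        by (intro mult const homogenisable_coordinate_quotient le cI that)
      then show ?thesis unfolding N_def using that by simp
    qed
    fix K :: "nat \<Rightarrow> 'k mat" and i
    assume K: "family ds n K" and i: "i < length ds" and nz: "minor (K i) {..<ds ! i} \<noteq> 0"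
    define S where "S = submatrix (K i) {..<ds ! i} UNIV"
    have Ki: "K i \<in> carrier_mat n (ds ! i)" using K i unfolding family_def by simp
    have S: "S \<in> carrier_mat (ds ! i) (ds ! i)"
      unfolding S_def by (rule submatrix_rows_carrier[OF Ki]) (use le[OF i] in auto)
    have detS: "det S \<noteq> 0" using nz unfolding S_def .
    obtain T where T: "T \<in> carrier_mat (ds ! i) (ds ! i)" "T * S = 1\<^sub>m (ds ! i)"
      using det_nonzero_inverse[OF S detS] by metis
    have KT: "K i * T \<in> carrier_mat n (ds ! i)" using Ki T by auto
    have K_eq: "K i * T * S = K i" using Ki T S by (simp add: assoc_mult_mat[of _ n "ds ! i" _ "ds ! i" _ "ds ! i"])
    have "K i * T = N (plucker K) i"
    proof (rule eq_matI)
      fix l s assume "l < dim_row (N (plucker K) i)" "s < dim_col (N (plucker K) i)"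
      then have l: "l < n" and s: "s < ds ! i" unfolding N_def by auto
      have "c i l s * minor (K i) (I i l s) = (K i * T) $$ (l, s) * det S"
        unfolding cI(3)[OF i l Ki, symmetric]
        using normalised_matrix_entry[OF KT S _ l s] unfolding K_eq
        using le[OF i] by (simp add: S_def submatrix_top[OF Ki])
      then show "(K i * T) $$ (l, s) = N (plucker K) i $$ (l, s)"
        using l s detS unfolding N_def plucker_def S_def by (simp add: field_simps)
    qed (use KT in \<open>auto simp: N_def\<close>)
    then show "K i = N (plucker K) i * submatrix (K i) {..<ds ! i} UNIV"
      using K_eq unfolding S_def by simp
  qed
qed

section \<open>Moving a point into the dense orbit\<close>

definition line :: "nat \<Rightarrow> nat \<Rightarrow> 'k::field mat \<Rightarrow> 'k mat \<Rightarrow> 'k \<Rightarrow> 'k mat" where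
  "line n d A B t = mat n d (\<lambda>(i, j). A $$ (i, j) + t * (B $$ (i, j) - A $$ (i, j)))"

lemma line_carrier [simp]: "line n d A B t \<in> carrier_mat n d"
  by (simp add: line_def)

lemma line_0: "A \<in> carrier_mat n d \<Longrightarrow> line n d A B 0 = A"
  by (rule eq_matI) (auto simp: line_def)

lemma line_1: "B \<in> carrier_mat n d \<Longrightarrow> line n d A B 1 = B"
  by (rule eq_matI) (auto simp: line_def)

lemma line_polynomial:
  assumes "i < n" "j < d"
  shows "polynomial_function (\<lambda>t. line n d A B t $$ (i, j))"
proof -
  have "polynomial_function (\<lambda>t. A $$ (i, j) + t * (B $$ (i, j) - A $$ (i, j)))"
    by (intro polynomial_function.add polynomial_function.mult polynomial_function.const polynomial_function_ident)
  then show ?thesis using assms by (simp add: line_def)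
qed

context block_index
begin

text \<open>The frame \<open>A\<close> splits \<open>n\<close>-space into the images of the coordinate blocks, and \<open>X\<close> describes the
  last subspace in the coordinates of this frame.\<close>

definition config :: "'k::field mat \<Rightarrow> 'k mat \<Rightarrow> nat \<Rightarrow> 'k mat" where
  "config A X i = (if i < length as then A * inclusion i else A * X)"

lemma family_config:
  assumes "A \<in> carrier_mat n n" "X \<in> carrier_mat n b"
  shows "family (as @ [b]) n (config A X)"
  unfolding family_def config_def using assms by (auto simp: nth_append less_Suc_eq)

lemma config_entry_algebra:
  assumes "function_algebra S" and A: "A \<in> carrier_mat n n" and X: "\<And>x. X x \<in> carrier_mat n b"
    and entries: "\<And>p q. p < n \<Longrightarrow> q < b \<Longrightarrow> S (\<lambda>x. X x $$ (p, q))"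
    and P: "multihom (as @ [b]) n e P"
  shows "S (\<lambda>x. P (plucker (config A (X x))))"
proof -
  interpret function_algebra S by fact
  show ?thesis
  proof (rule multihom[OF P])
    fix i I assume i: "i < length (as @ [b])" and I: "I \<subseteq> {..<n}" "card I = (as @ [b]) ! i"
    show "S (\<lambda>x. plucker (config A (X x)) i I)"
    proof (cases "i < length as")
      case True
      then show ?thesis by (simp add: plucker_def config_def const)
    next
      case False
      then have "i = length as" using i by simp
      then have "card I = b" using I by simp
      then have "S (\<lambda>x. minor (A * X x) I)"
        by (intro minor[OF _ I(1)] mat_mult_entry[OF _ X] const entries) (use A X in auto)
      then show ?thesis using False by (simp add: plucker_def config_def)
    qed
  qed
qed

text \<open>Generic subspaces of dimensions \<open>as ! i\<close> are in direct sum, because these dimensions add up to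
  \<open>n\<close>. So a polynomial that is nonzero anywhere is nonzero at a configuration that comes from an
  invertible frame.\<close>

lemma generic_frame:
  fixes M :: "nat \<Rightarrow> 'k::alg_closed_field mat"
  assumes P: "multihom (as @ [b]) n e P" and M: "family (as @ [b]) n M" and nz: "P (plucker M) \<noteq> 0"
  obtains A X where "A \<in> carrier_mat n n" "det A \<noteq> 0" "X \<in> carrier_mat n b" "P (plucker (config A X)) \<noteq> 0"
proof -
  define A0 where "A0 = mat n n (\<lambda>(p, q). M (fst (blk q)) $$ (p, snd (blk q)))"
  have A0: "A0 \<in> carrier_mat n n" unfolding A0_def by simp
  have Mi: "M i \<in> carrier_mat n (as ! i)" if "i < length as" for i
    using M that unfolding family_def by (auto simp: nth_append dest: spec[of _ i])
  have Mb: "M (length as) \<in> carrier_mat n b" using M unfolding family_def by auto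
  have A0_inc: "A0 * inclusion i = M i" if i: "i < length as" for i
    unfolding mult_inclusion[OF A0 i]
    by (rule eq_matI) (use Mi[OF i] i blk_pos pos_less in \<open>auto simp: A0_def\<close>)
  \<comment> \<open>Move the concatenated matrix \<open>A0\<close> towards the identity and leave the last subspace fixed.\<close>
  define F where "F t i = (if i < length as then line n n A0 (1\<^sub>m n) t * inclusion i else M (length as))" for t i
  have "polynomial_function (\<lambda>t. P (plucker (F t)))"
  proof (rule polynomial_function.multihom[OF P])
    fix i I assume i: "i < length (as @ [b])" and I: "I \<subseteq> {..<n}" "card I = (as @ [b]) ! i"
    show "polynomial_function (\<lambda>t. plucker (F t) i I)"
    proof (cases "i < length as")
      case True
      have "card I = as ! i" using True I by (simp add: nth_append)
      have "polynomial_function (\<lambda>t. (line n n A0 (1\<^sub>m n) t * inclusion i) $$ (p, q))"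
        if "p < n" "q < as ! i" for p q
        by (rule polynomial_function.mat_mult_entry[OF line_carrier carrier_blocks(1) line_polynomial
              polynomial_function.const that])
      then have "polynomial_function (\<lambda>t. minor (line n n A0 (1\<^sub>m n) t * inclusion i) I)"
        by (rule polynomial_function.minor[OF mult_carrier_mat[OF line_carrier carrier_blocks(1)] I(1) \<open>card I = as ! i\<close>])
      then show ?thesis using True by (simp add: plucker_def F_def)
    qed (simp add: plucker_def F_def polynomial_function.const)
  qed
  moreover have "polynomial_function (\<lambda>t. det (line n n A0 (1\<^sub>m n) t))"
    by (rule polynomial_function.det[where d = n]) (auto intro: line_polynomial)
  moreover have "P (plucker (F 0)) = P (plucker M)"
    by (rule multihom_cong[OF P]) (auto simp: plucker_def F_def line_0[OF A0] A0_inc less_Suc_eq)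
  then have "P (plucker (F 0)) \<noteq> 0" using nz by simp
  moreover have "det (line n n A0 (1\<^sub>m n) 1) \<noteq> 0" by (simp add: line_1)
  ultimately obtain u where u: "P (plucker (F u)) \<noteq> 0" "det (line n n A0 (1\<^sub>m n) u) \<noteq> 0"
    by (rule polynomial_functions_common_nonzero)
  define A where "A = line n n A0 (1\<^sub>m n) u"
  have A: "A \<in> carrier_mat n n" "det A \<noteq> 0" unfolding A_def using u by auto
  obtain B where B: "B \<in> carrier_mat n n" "A * B = 1\<^sub>m n" using det_nonzero_inverse[OF A] by metis
  have "A * (B * M (length as)) = M (length as)"
    using assoc_mult_mat[OF A(1) B(1) Mb] B(2) Mb by simp
  then have "config A (B * M (length as)) = F u" unfolding config_def F_def A_def by auto
  then show ?thesis using that[OF A, of "B * M (length as)"] u(1) B(1) Mb by auto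
qed

text \<open>Within a fixed frame, the blocks of the last matrix can be moved into the chart.\<close>

lemma generic_blocks:
  fixes A :: "'k::alg_closed_field mat"
  assumes P: "multihom (as @ [b]) n e P" and le: "\<And>i. i < length as \<Longrightarrow> as ! i \<le> b"
    and A: "A \<in> carrier_mat n n" and X: "X \<in> carrier_mat n b" and nz: "P (plucker (config A X)) \<noteq> 0"
  obtains K where "family as b K" "\<And>i. i < length as \<Longrightarrow> minor (K i) {..<as ! i} \<noteq> 0"
    "P (plucker (config A (stack b K))) \<noteq> 0"
proof -
  \<comment> \<open>A point of the chart: this needs at least as many rows as columns, that is, \<open>as ! i \<le> b\<close>.\<close>
  define T where "T i = (mat b (as ! i) (\<lambda>(l, s). if l = s then 1 else 0) :: 'k mat)" for i
  have T: "T i \<in> carrier_mat b (as ! i)" for i unfolding T_def by simp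
  let ?X = "line n b X (stack b T)"
  have "polynomial_function (\<lambda>t. P (plucker (config A (?X t))))"
    by (rule config_entry_algebra[OF polynomial_function.function_algebra_axioms A _ _ P])
       (auto intro: line_polynomial)
  moreover have "polynomial_function (\<lambda>t. \<Prod>i<length as. minor (unstack b (?X t) i) {..<as ! i})"
  proof (intro polynomial_function.prod polynomial_function.minor)
    fix i l s assume i: "i \<in> {..<length as}" and l: "l < b" and s: "s < as ! i"
    have "polynomial_function (\<lambda>t. ?X t $$ (pos (i, s), l))"
      using i l s by (intro line_polynomial pos_less) auto
    then show "polynomial_function (\<lambda>t. unstack b (?X t) i $$ (l, s))"
      using l s by (simp add: unstack_def)
  qed (use le in auto)
  moreover have "P (plucker (config A (?X 0))) \<noteq> 0" using nz by (simp add: line_0[OF X])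
  moreover have "(\<Prod>i<length as. minor (unstack b (?X 1) i) {..<as ! i}) \<noteq> 0"
  proof -
    have "minor (unstack b (?X 1) i) {..<as ! i} = 1" if i: "i < length as" for i
    proof -
      have "submatrix (T i) {..<as ! i} UNIV = 1\<^sub>m (as ! i)"
        unfolding submatrix_top[OF T le[OF i]] using le[OF i] by (intro eq_matI) (auto simp: T_def)
      then show ?thesis by (simp add: line_1 unstack_stack[of i T, OF i T])
    qed
    then show ?thesis by simp
  qed
  ultimately obtain u where u: "P (plucker (config A (?X u))) \<noteq> 0"
    "(\<Prod>i<length as. minor (unstack b (?X u) i) {..<as ! i}) \<noteq> 0"
    by (rule polynomial_functions_common_nonzero)
  show ?thesis
  proof (rule that[of "unstack b (?X u)"])
    show "family as b (unstack b (?X u))" by (simp add: family_def)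
    show "minor (unstack b (?X u) i) {..<as ! i} \<noteq> 0" if "i < length as" for i
      using u(2) that by (simp add: prod_zero_iff)
    show "P (plucker (config A (stack b (unstack b (?X u))))) \<noteq> 0"
      using u(1) by (simp add: stack_unstack)
  qed
qed

text \<open>The transfer of density. A polynomial \<open>P\<close> that is nonzero somewhere is nonzero at a
  configuration with frame \<open>A\<close> and last matrix \<open>stack b K\<close>. Keep \<open>A\<close> and the top blocks of the
  \<open>K i\<close>, and let the column spaces of the \<open>K i\<close> vary: after homogenisation \<open>P\<close> is a nonzero
  multihomogeneous polynomial on the product of Grassmannians of \<open>b\<close>-space, so it is nonzero
  somewhere on the dense orbit.\<close>

lemma dense_orbit_meets:
  fixes Rs :: "'k::alg_closed_field vec set list"
  assumes le: "\<And>i. i < length as \<Longrightarrow> as ! i \<le> b"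
    and dense: "zariski as b closure_of diagonal_orbit b Rs = prod_grassmannian as b"
    and len: "length Rs = length as"
    and P: "multihom (as @ [b]) n e P" and M: "family (as @ [b]) n M" and nz: "P (plucker M) \<noteq> 0"
  obtains A G L where "A \<in> carrier_mat n n" "det A \<noteq> 0" "G \<in> carrier_mat b b" "det G \<noteq> 0"
    "family as b L" "\<And>i. i < length as \<Longrightarrow> inj_mat (L i)"
    "\<And>i. i < length as \<Longrightarrow> col_space b (L i) = pgl_act {c \<cdot>\<^sub>m G | c. c \<noteq> 0} (Rs ! i)"
    "P (plucker (config A (stack b L))) \<noteq> 0"
proof -
  obtain A X where A: "A \<in> carrier_mat n n" "det A \<noteq> 0" and X: "X \<in> carrier_mat n b" "P (plucker (config A X)) \<noteq> 0"
    using generic_frame[OF P M nz] by blast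
  obtain K where K: "family as b K" "\<And>i. i < length as \<Longrightarrow> minor (K i) {..<as ! i} \<noteq> 0"
    "P (plucker (config A (stack b K))) \<noteq> 0"
    using generic_blocks[OF P le A(1) X] by blast
  obtain N :: "(nat \<Rightarrow> nat set \<Rightarrow> 'k) \<Rightarrow> nat \<Rightarrow> 'k mat" where N:
    "\<And>x i. N x i \<in> carrier_mat b (as ! i)"
    "\<And>i l s. i < length as \<Longrightarrow> l < b \<Longrightarrow> s < as ! i \<Longrightarrow> homogenisable as b (\<lambda>x. N x i $$ (l, s))"
    "\<And>K i. family as b K \<Longrightarrow> i < length as \<Longrightarrow> minor (K i) {..<as ! i} \<noteq> 0 \<Longrightarrow>
       K i = N (plucker K) i * submatrix (K i) {..<as ! i} UNIV"
    using normal_form_of_plucker_coordinates[of as b, OF le] by blast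
  define D where "D i = submatrix (K i) {..<as ! i} UNIV" for i
  have top: "submatrix (J i) {..<as ! i} UNIV \<in> carrier_mat (as ! i) (as ! i)"
    if "family as b J" "i < length as" for J :: "nat \<Rightarrow> 'k mat" and i
    using that le[OF that(2)] unfolding family_def by (intro submatrix_rows_carrier[of _ b]) auto
  have D: "D i \<in> carrier_mat (as ! i) (as ! i)" "det (D i) \<noteq> 0" if "i < length as" for i
    unfolding D_def using top[OF K(1) that] K(2)[OF that] by auto
  define f where "f x = P (plucker (config A (stack b (\<lambda>i. N x i * D i))))" for x
  have alg: "function_algebra (homogenisable as b :: ((nat \<Rightarrow> nat set \<Rightarrow> 'k) \<Rightarrow> 'k) \<Rightarrow> bool)"
    by (rule function_algebra_homogenisable[OF le])
  have "homogenisable as b f" unfolding f_def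
  proof (rule config_entry_algebra[OF alg A(1) _ _ P])
    fix p q assume p: "p < n" and q: "q < b"
    have "homogenisable as b (\<lambda>x. (N x (fst (blk p)) * D (fst (blk p))) $$ (q, snd (blk p)))"
      by (rule function_algebra.mat_mult_entry[OF alg N(1) D(1)])
         (use blk_less[OF p] q in \<open>auto intro: N(2) function_algebra.const[OF alg]\<close>)
    then show "homogenisable as b (\<lambda>x. stack b (\<lambda>i. N x i * D i) $$ (p, q))"
      using p q by (simp add: stack_def)
  qed simp
  then obtain m Q where Q: "multihom as b (\<lambda>j. if j < length as then m else 0) Q"
    "\<And>x. chart as x \<noteq> 0 \<Longrightarrow> Q x = chart as x ^ m * f x"
    unfolding homogenisable_def by blast
  \<comment> \<open>The extra factor keeps the point of the orbit inside the chart, where \<open>Q\<close> computes \<open>f\<close>.\<close>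
  have QC: "multihom as b (\<lambda>j. (if j < length as then m else 0) + (if j < length as then 1 else 0))
      (\<lambda>x. Q x * chart as x ^ 1)"
    by (rule multihom.mult[OF Q(1) multihom_chart_power[OF le]])
  have chart: "chart as (plucker K) \<noteq> 0" using K(2) by (simp add: chart_def plucker_def)
  have "stack b (\<lambda>i. N (plucker K) i * D i) = stack b K"
    by (rule stack_cong) (use N(3)[OF K(1) _ K(2)] in \<open>simp add: D_def\<close>)
  then have "f (plucker K) \<noteq> 0" using K(3) unfolding f_def by simp
  then have "Q (plucker K) * chart as (plucker K) ^ 1 \<noteq> 0" using Q(2)[OF chart] chart by simp
  moreover have injK: "inj_mat (J i)" if "family as b J" "i < length as" "minor (J i) {..<as ! i} \<noteq> 0"
    for J :: "nat \<Rightarrow> 'k mat" and i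
    using that le[OF that(2)] unfolding family_def
    by (intro minor_nonzero_imp_inj_mat[of _ b "as ! i" "{..<as ! i}"]) auto
  ultimately have "col_spaces as b K \<in> nonvanishing_locus as b (\<lambda>x. Q x * chart as x ^ 1)"
    unfolding nonvanishing_locus_iff[OF QC] using K(1,2)
    by (intro conjI col_spaces_in_prod_grassmannian exI[of _ K]) (auto simp: col_spaces_def)
  then obtain Us where Us: "Us \<in> nonvanishing_locus as b (\<lambda>x. Q x * chart as x ^ 1)" "Us \<in> diagonal_orbit b Rs"
    using dense QC unfolding zariski_dense_iff by blast
  obtain g where g: "g \<in> PGL b" "Us = map (pgl_act g) Rs" using Us(2) unfolding diagonal_orbit_def by blast
  obtain G where G: "G \<in> carrier_mat b b" "det G \<noteq> 0" "g = {c \<cdot>\<^sub>m G | c. c \<noteq> 0}"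
    using g(1) unfolding PGL_iff by blast
  obtain J where J: "family as b J" "\<And>i. i < length as \<Longrightarrow> col_space b (J i) = Us ! i"
    "Q (plucker J) * chart as (plucker J) ^ 1 \<noteq> 0"
    using Us(1) unfolding nonvanishing_locus_iff[OF QC] by blast
  then have chartJ: "chart as (plucker J) \<noteq> 0" by auto
  then have minJ: "minor (J i) {..<as ! i} \<noteq> 0" if "i < length as" for i
    using that by (simp add: chart_def plucker_def)
  have fJ: "f (plucker J) \<noteq> 0" using J(3) Q(2)[OF chartJ] by auto
  define L where "L i = N (plucker J) i * D i" for i
  have L: "family as b L" unfolding family_def L_def using mult_carrier_mat[OF N(1) D(1)] by blast
  \<comment> \<open>The matrices \<open>L i\<close> and \<open>J i\<close> differ only in their top blocks, so they span the same space.\<close>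
  have L_eq: "\<exists>H. H \<in> carrier_mat (as ! i) (as ! i) \<and> det H \<noteq> 0 \<and> L i = J i * H" if i: "i < length as" for i
  proof -
    define S where "S = submatrix (J i) {..<as ! i} UNIV"
    have S: "S \<in> carrier_mat (as ! i) (as ! i)" "det S \<noteq> 0" "J i = N (plucker J) i * S"
      unfolding S_def using top[OF J(1) i] minJ[OF i] N(3)[OF J(1) i minJ[OF i]] by auto
    obtain S' where S': "S' \<in> carrier_mat (as ! i) (as ! i)" "det S' \<noteq> 0" "S * S' = 1\<^sub>m (as ! i)"
      using det_nonzero_inverse[OF S(1,2)] by metis
    have "J i * (S' * D i) = N (plucker J) i * (S * (S' * D i))"
      unfolding S(3) using N(1) S(1) S'(1) D(1)[OF i] by (intro assoc_mult_mat) auto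
    also have "S * (S' * D i) = S * S' * D i"
      using S(1) S'(1) D(1)[OF i] by (intro assoc_mult_mat[symmetric]) auto
    also have "\<dots> = D i" unfolding S'(3) using D(1)[OF i] by simp
    finally have "L i = J i * (S' * D i)" unfolding L_def by simp
    then show ?thesis using S' D[OF i] det_mult[OF S'(1) D(1)[OF i]]
      by (intro exI[of _ "S' * D i"]) auto
  qed
  show ?thesis
  proof (rule that[OF A G(1,2) L])
    fix i assume i: "i < length as"
    obtain H where H: "H \<in> carrier_mat (as ! i) (as ! i)" "det H \<noteq> 0" "L i = J i * H" using L_eq[OF i] by blast
    have Ji: "J i \<in> carrier_mat b (as ! i)" using J(1) i unfolding family_def by simp
    show "inj_mat (L i)" unfolding H(3)
      using inj_mat_mult[OF Ji H(1) injK[OF J(1) i minJ[OF i]]] inj_mat_det_iff[OF H(1)] H(2) by blast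
    show "col_space b (L i) = pgl_act {c \<cdot>\<^sub>m G | c. c \<noteq> 0} (Rs ! i)"
      unfolding H(3) col_space_mult_invertible[OF Ji H(1,2)] J(2)[OF i] g(2) G(3)[symmetric]
      using i len by simp
  next
    show "P (plucker (config A (stack b L))) \<noteq> 0" using fJ unfolding f_def L_def .
  qed
qed

text \<open>The candidate for the point with dense orbit is the stack over a point of the given dense
  orbit, but it must be \<open>b\<close>-dimensional. Having a nonzero leading Pluecker coordinate is an open
  condition satisfied by some \<open>b\<close>-dimensional subspace, so it can be met over the orbit.\<close>

lemma full_rank_stack_over_orbit:
  fixes Rs :: "'k::alg_closed_field vec set list"
  assumes le: "\<And>i. i < length as \<Longrightarrow> as ! i \<le> b" and bn: "b \<le> n"
    and dense: "zariski as b closure_of diagonal_orbit b Rs = prod_grassmannian as b"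
    and len: "length Rs = length as"
  obtains G L where "G \<in> carrier_mat b b" "det G \<noteq> 0"
    "family as b L" "\<And>i. i < length as \<Longrightarrow> inj_mat (L i)"
    "\<And>i. i < length as \<Longrightarrow> col_space b (L i) = pgl_act {c \<cdot>\<^sub>m G | c. c \<noteq> 0} (Rs ! i)"
    "inj_mat (stack b L)"
proof -
  let ?r = "length as"
  let ?P = "\<lambda>x :: nat \<Rightarrow> nat set \<Rightarrow> 'k. x ?r {..<b}"
  have P: "multihom (as @ [b]) n (\<lambda>j. if j = ?r then 1 else 0) ?P"
    by (rule multihom.var) (use bn in auto)
  define X where "X = (mat n b (\<lambda>(p, q). if p = q then 1 else 0) :: 'k mat)"
  have X: "X \<in> carrier_mat n b" unfolding X_def by simp
  have "submatrix X {..<b} UNIV = 1\<^sub>m b"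
    unfolding submatrix_top[OF X bn] using bn by (intro eq_matI) (auto simp: X_def)
  then have "?P (plucker (config (1\<^sub>m n) X)) \<noteq> 0" using X by (simp add: plucker_def config_def)
  then obtain A G L where AGL: "A \<in> carrier_mat n n" "det A \<noteq> 0" "G \<in> carrier_mat b b" "det G \<noteq> 0"
    "family as b L" "\<And>i. i < length as \<Longrightarrow> inj_mat (L i)"
    "\<And>i. i < length as \<Longrightarrow> col_space b (L i) = pgl_act {c \<cdot>\<^sub>m G | c. c \<noteq> 0} (Rs ! i)"
    "?P (plucker (config A (stack b L))) \<noteq> 0"
    using dense_orbit_meets[OF le dense len P family_config[OF one_carrier_mat X]] by blast
  have "minor (A * stack b L) {..<b} \<noteq> 0" using AGL(8) by (simp add: plucker_def config_def)
  then have "inj_mat (A * stack b L)"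
    by (intro minor_nonzero_imp_inj_mat[of _ n b "{..<b}"]) (use AGL(1) bn in auto)
  then have "inj_mat (stack b L)" by (rule inj_mat_mult_leftD[OF AGL(1) carrier_blocks(2)])
  then show ?thesis using that AGL by blast
qed

text \<open>The point \<open>Ws\<close> consists of the coordinate blocks and the column space of \<open>stack b L0\<close>, with
  \<open>L0\<close> over the dense orbit. Any other stack over the orbit is obtained from it by a block diagonal
  matrix, which stabilises the coordinate blocks, and a change of basis of the last subspace;
  together with the frame \<open>A\<close> this is one element of \<open>GL(n)\<close>.\<close>

lemma dense_dv_append:
  assumes le: "\<And>i. i < length as \<Longrightarrow> as ! i \<le> b" and bn: "b \<le> n"
    and d: "dense_dv TYPE('k::alg_closed_field) as b"
  shows "dense_dv TYPE('k) (as @ [b]) n"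
proof -
  let ?r = "length as"
  obtain Rs :: "'k vec set list" where Rs: "Rs \<in> prod_grassmannian as b"
    and dense: "zariski as b closure_of diagonal_orbit b Rs = prod_grassmannian as b"
    using d unfolding dense_dv_def by blast
  have len: "length Rs = ?r" using Rs unfolding prod_grassmannian_iff by simp
  obtain C where C: "family as b C" "\<And>i. i < ?r \<Longrightarrow> col_space b (C i) = Rs ! i"
    using prod_grassmannian_matrices[OF Rs] by metis
  obtain G0 L0 where G0: "G0 \<in> carrier_mat b b" "det G0 \<noteq> 0" and L0: "family as b L0"
    "\<And>i. i < ?r \<Longrightarrow> inj_mat (L0 i)"
    "\<And>i. i < ?r \<Longrightarrow> col_space b (L0 i) = pgl_act {c \<cdot>\<^sub>m G0 | c. c \<noteq> 0} (Rs ! i)"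
    and inj0: "inj_mat (stack b L0)"
    using full_rank_stack_over_orbit[OF le bn dense len] by blast
  obtain G0' where G0': "G0' \<in> carrier_mat b b" "det G0' \<noteq> 0" "G0' * G0 = 1\<^sub>m b"
    using det_nonzero_inverse[OF G0] by metis
  let ?W = "config (1\<^sub>m n) (stack b L0)"
  have W: "family (as @ [b]) n ?W" by (rule family_config) auto
  define Ws where "Ws = col_spaces (as @ [b]) n ?W"
  have injW: "inj_mat (?W i)" if "i < length (as @ [b])" for i
    using that inj0 by (auto simp: config_def inj_mat_inclusion
        left_mult_one_mat[OF carrier_blocks(1)] left_mult_one_mat[OF carrier_blocks(2)])
  then have W_in: "Ws \<in> prod_grassmannian (as @ [b]) n"
    unfolding Ws_def by (rule col_spaces_in_prod_grassmannian[OF W])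
  have "zariski (as @ [b]) n closure_of diagonal_orbit n Ws = prod_grassmannian (as @ [b]) n"
    unfolding zariski_dense_iff
  proof (intro allI impI)
    fix e and P :: "(nat \<Rightarrow> nat set \<Rightarrow> 'k) \<Rightarrow> 'k"
    assume P: "multihom (as @ [b]) n e P" and "nonvanishing_locus (as @ [b]) n P \<noteq> {}"
    then obtain M where M: "family (as @ [b]) n M" "P (plucker M) \<noteq> 0"
      using nonvanishing_locus_iff[OF P] by blast
    obtain A G L where A: "A \<in> carrier_mat n n" "det A \<noteq> 0" and G: "G \<in> carrier_mat b b" "det G \<noteq> 0"
      and L: "family as b L" "\<And>i. i < ?r \<Longrightarrow> inj_mat (L i)"
      "\<And>i. i < ?r \<Longrightarrow> col_space b (L i) = pgl_act {c \<cdot>\<^sub>m G | c. c \<noteq> 0} (Rs ! i)"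
      and nz: "P (plucker (config A (stack b L))) \<noteq> 0"
      using dense_orbit_meets[OF le dense len P M] by blast
    define h where "h = (G * G0')\<^sup>T"
    have h: "h \<in> carrier_mat b b" unfolding h_def using G G0' by auto
    have deth: "det h \<noteq> 0" unfolding h_def
      using det_transpose[of "G * G0'" b] det_mult[OF G(1) G0'(1)] G G0' by auto
    \<comment> \<open>\<open>h\<^sup>T\<close> carries the column space of \<open>L0 i\<close> to that of \<open>L i\<close>; \<open>D\<close> is the remaining change of
      basis. Both spaces are translates of the \<open>i\<close>-th entry of \<open>Rs\<close>, by \<open>G0\<close> and by \<open>G\<close>.\<close>
    have "\<exists>D. D \<in> carrier_mat (as ! i) (as ! i) \<and> det D \<noteq> 0 \<and> L i = h\<^sup>T * (L0 i * D)" if i: "i < ?r" for i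
    proof -
      have Li: "L i \<in> carrier_mat b (as ! i)" and L0i: "L0 i \<in> carrier_mat b (as ! i)" and Ci: "C i \<in> carrier_mat b (as ! i)"
        using L(1) L0(1) C(1) i unfolding family_def by auto
      have hL0: "h\<^sup>T * L0 i \<in> carrier_mat b (as ! i)" using h L0i by auto
      have "G * C i = h\<^sup>T * (G0 * C i)"
      proof -
        have "h\<^sup>T * (G0 * C i) = G * (G0' * (G0 * C i))"
          unfolding h_def using G G0' G0 Ci by (simp add: assoc_mult_mat[of _ b b _ b _ "as ! i"])
        also have "G0' * (G0 * C i) = G0' * G0 * C i" by (rule assoc_mult_mat[symmetric]) (use G0 G0' Ci in auto)
        finally show ?thesis unfolding G0'(3) using Ci by simp
      qed
      moreover obtain H where H: "H \<in> carrier_mat (as ! i) (as ! i)" "L0 i = G0 * C i * H"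
      proof (rule col_space_subsetD[of "G0 * C i" b "as ! i" "L0 i" "as ! i"])
        show "col_space b (L0 i) \<subseteq> col_space b (G0 * C i)"
          using pgl_act_col_space[OF G0(1) Ci] L0(3)[OF i] C(2)[OF i] by simp
      qed (use G0 Ci L0i in auto)
      moreover have "det H \<noteq> 0"
        using inj_mat_mult_leftD[of "G0 * C i" b "as ! i" H "as ! i"] H L0(2)[OF i] inj_mat_det_iff[OF H(1)] G0 Ci by auto
      ultimately have "h\<^sup>T * L0 i = G * C i * H" and detH: "det H \<noteq> 0"
        using h G0 Ci H(1) by (auto simp: assoc_mult_mat[of _ b b _ "as ! i" _ "as ! i"])
      then have "col_space b (h\<^sup>T * L0 i) = col_space b (G * C i)"
        using col_space_mult_invertible[of "G * C i" b "as ! i" H] G Ci H by auto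
      also have "\<dots> = col_space b (L i)"
        using pgl_act_col_space[OF G(1) Ci] L(3)[OF i] C(2)[OF i] by simp
      finally obtain D where "D \<in> carrier_mat (as ! i) (as ! i)" "det D \<noteq> 0" "L i = h\<^sup>T * L0 i * D"
        using same_col_space[OF hL0 Li L(2)[OF i]] by metis
      then show ?thesis using h L0i by (auto simp: assoc_mult_mat[of _ b b _ "as ! i" _ "as ! i"])
    qed
    then obtain D where D: "\<And>i. i < ?r \<Longrightarrow> D i \<in> carrier_mat (as ! i) (as ! i)" "\<And>i. i < ?r \<Longrightarrow> det (D i) \<noteq> 0"
      "\<And>i. i < ?r \<Longrightarrow> L i = h\<^sup>T * (L0 i * D i)"
      by metis
    have L0i: "L0 i \<in> carrier_mat b (as ! i)" if "i < ?r" for i using L0(1) that unfolding family_def by simp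
    define E where "E = A * block_diag D"
    have E: "E \<in> carrier_mat n n" unfolding E_def using A by auto
    have detE: "det E \<noteq> 0"
      unfolding E_def using det_mult[OF A(1), of "block_diag D"] A(2) det_block_diag_nonzero[of D] D(1,2) by simp
    have "stack b L = stack b (\<lambda>i. h\<^sup>T * (L0 i * D i))" by (rule stack_cong) (rule D(3))
    also have "\<dots> = stack b (\<lambda>i. L0 i * D i) * h"
      by (rule stack_mult[OF h, symmetric]) (rule mult_carrier_mat[OF L0i D(1)])
    also have "stack b (\<lambda>i. L0 i * D i) = block_diag D * stack b L0"
      by (rule block_diag_mult_stack[symmetric]) (use L0i D(1) in auto)
    finally have "A * stack b L = A * (block_diag D * stack b L0 * h)" by simp
    also have "\<dots> = A * (block_diag D * stack b L0) * h"
      by (rule assoc_mult_mat[symmetric, OF A(1) mult_carrier_mat[OF carrier_blocks(4) carrier_blocks(2)] h])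
    also have "A * (block_diag D * stack b L0) = E * stack b L0"
      unfolding E_def by (rule assoc_mult_mat[symmetric, OF A(1) carrier_blocks(4) carrier_blocks(2)])
    finally have "A * stack b L = E * stack b L0 * h" .
    then have last: "col_space n (A * stack b L) = col_space n (E * stack b L0)"
      using col_space_mult_invertible[of "E * stack b L0" n b h] E h deth by auto
    have first: "col_space n (A * inclusion i) = col_space n (E * inclusion i)" if i: "i < ?r" for i
    proof -
      have "E * inclusion i = A * (block_diag D * inclusion i)"
        unfolding E_def using A(1) by (intro assoc_mult_mat) auto
      also have "\<dots> = A * inclusion i * (D i)\<^sup>T"
        unfolding block_diag_mult_inclusion[of i D, OF i D(1)[OF i]]
        using A(1) D(1)[OF i] by (intro assoc_mult_mat[symmetric]) auto
      finally show ?thesis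
        using col_space_mult_invertible[of "A * inclusion i" n "as ! i" "(D i)\<^sup>T"] A(1) D(1,2)[OF i] det_transpose[OF D(1)[OF i]]
        by auto
    qed
    define g where "g = {c \<cdot>\<^sub>m E | c. c \<noteq> 0}"
    have "g \<in> PGL n" unfolding PGL_iff g_def using E detE by blast
    then have orbit: "map (pgl_act g) Ws \<in> diagonal_orbit n Ws" unfolding diagonal_orbit_def by blast
    let ?V = "config E (stack b L0)"
    have carW: "?W i \<in> carrier_mat n ((as @ [b]) ! i)" if "i < length (as @ [b])" for i
      using W that unfolding family_def by blast
    have V_eq: "?V i = E * ?W i" if "i < length (as @ [b])" for i
      by (simp add: config_def left_mult_one_mat[OF carrier_blocks(1)] left_mult_one_mat[OF carrier_blocks(2)])
    have gWs: "map (pgl_act g) Ws = col_spaces (as @ [b]) n ?V"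
      using pgl_act_col_space[OF E carW] V_eq unfolding Ws_def col_spaces_def g_def by simp
    have "col_space n (config A (stack b L) i) = map (pgl_act g) Ws ! i" if i: "i < length (as @ [b])" for i
      unfolding gWs nth_col_spaces[OF i] using first last by (simp add: config_def)
    moreover have "map (pgl_act g) Ws \<in> prod_grassmannian (as @ [b]) n"
      unfolding gWs
    proof (rule col_spaces_in_prod_grassmannian[OF family_config[OF E carrier_blocks(2)]])
      fix i assume i: "i < length (as @ [b])"
      show "inj_mat (?V i)" unfolding V_eq[OF i]
        using inj_mat_mult[OF E carW[OF i]] inj_mat_det_iff[OF E] detE injW[OF i] by blast
    qed
    ultimately have "map (pgl_act g) Ws \<in> nonvanishing_locus (as @ [b]) n P"
      unfolding nonvanishing_locus_iff[OF P] using family_config[OF A(1) carrier_blocks(2)] nz by blast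
    then show "nonvanishing_locus (as @ [b]) n P \<inter> diagonal_orbit n Ws \<noteq> {}" using orbit by blast
  qed
  then show ?thesis using W_in unfolding dense_dv_def by blast
qed

end

lemma exists_block_index:
  obtains blk where "block_index as (sum_list as) blk"
proof -
  have "card (SIGMA i:{..<length as}. {..<as ! i}) = (\<Sum>i<length as. as ! i)" by simp
  also have "\<dots> = sum_list as" by (simp add: sum_list_sum_nth atLeast0LessThan)
  finally have "card {..<sum_list as} = card (SIGMA i:{..<length as}. {..<as ! i})" by simp
  then obtain blk where "bij_betw blk {..<sum_list as} (SIGMA i:{..<length as}. {..<as ! i})"
    using finite_same_card_bij[of "{..<sum_list as}" "SIGMA i:{..<length as}. {..<as ! i}"] by auto
  then show ?thesis using that unfolding block_index_def by blast
qed

theorem lemma4p7: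
  fixes as :: "nat list" and b n :: nat
  assumes "dimension_vector (as @ [b]) n"
    and "sum_list as = n"
    and "dv_size (as @ [b]) = b"
    and "\<forall>a\<in>set as. a + b \<le> n"
    and "dense_dv TYPE('k::alg_closed_field) as b"
  shows "dense_dv TYPE('k::alg_closed_field) (as @ [b]) n"
proof -
  obtain blk where "block_index as n blk" using exists_block_index[of as] assms(2) by metis
  then interpret block_index as n blk .
  have "as ! i \<le> b" if "i < length as" for i
  proof -
    have "as ! i \<in> set (as @ [b])" using that by simp
    then have "as ! i \<le> Max (set (as @ [b]))" by (intro Max_ge) auto
    then show ?thesis using assms(3) unfolding dv_size_def by simp
  qed
  moreover have "b \<le> n" using assms(1) unfolding dimension_vector_def by auto
  ultimately show ?thesis using assms(5) by (rule dense_dv_append)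
qed

end
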